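(* Let $\lambda\in\mathbb{R}$, $\lambda\ne0$, let $s\ge 4$, and let $\gamma_0\in H^s(\mathbb{R})$ have compact support. Consider the Cauchy problem $$\begin{cases}\gamma_t=\lambda\Big(v_x-\gamma-\dfrac1\lambda v\gamma\Big)_x, & t>0,\ x\in\mathbb{R},\\[4pt] v_{xx}=\gamma_x+\dfrac{\gamma^2}{2\lambda}, & t\ge0,\ x\in\mathbb{R},\\[4pt] \gamma(0,x)=\gamma_0(x), & x\in\mathbb{R}.\end{cases}$$ If $T=T(\gamma_0)>0$ is the maximal existence time of the unique solution $\gamma(t,x)$ of this problem with initial data $\gamma_0$, then for every $t\in[0,T)$ the function $\gamma(t,\cdot)$ has compact support.
   Context: $H^s(\mathbb{R})$ is the usual $L^2$-based Sobolev space. The solution is a classical solution: $\gamma\in C([0,T);H^s(\mathbb{R}))\cap C^1([0,T);H^{s-1}(\mathbb{R}))$, together with a function $v$ on $[0,T)\times\mathbb{R}$ such that $v,v_x,v_{xx}$ are continuous and the equations hold pointwise. *)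

theory Defs
  imports "HOL-Analysis.Analysis"
begin

definition square_integrable :: "(real \<Rightarrow> 'a::real_normed_vector) \<Rightarrow> bool" where
  "square_integrable f \<longleftrightarrow>
     f \<in> borel_measurable lborel \<and> integrable lborel (\<lambda>x. (norm (f x))\<^sup>2)"

text \<open>
  The Fourier-Plancherel transform of a square integrable function is the limit in the mean of the
  truncated Fourier integrals, with kernel \<open>exp (- i x \<xi>)\<close>. It is determined only up to null sets,
  so it appears first as a relation. The mean-square distance is an extended nonnegative
  integral, because the Bochner integral of a non-integrable function is \<open>0\<close>.
\<close>

definition truncated_fourier :: "(real \<Rightarrow> real) \<Rightarrow> real \<Rightarrow> real \<Rightarrow> complex" where
  "truncated_fourier f R \<xi> = (LINT x:{-R..R}|lborel. complex_of_real (f x) * cis (- (x * \<xi>)))"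

definition is_fourier :: "(real \<Rightarrow> real) \<Rightarrow> (real \<Rightarrow> complex) \<Rightarrow> bool" where
  "is_fourier f g \<longleftrightarrow> square_integrable g \<and>
     ((\<lambda>R. \<integral>\<^sup>+ \<xi>. ennreal ((norm (truncated_fourier f R \<xi> - g \<xi>))\<^sup>2) \<partial>lborel) \<longlongrightarrow> 0) at_top"

definition fourier :: "(real \<Rightarrow> real) \<Rightarrow> real \<Rightarrow> complex" where
  "fourier f = (SOME g. is_fourier f g)"

text \<open>
  The space \<open>H\<^sup>s\<close> of real functions on the line, for \<open>s \<ge> 0\<close> only (for negative \<open>s\<close> it would
  contain distributions that are not functions). Its elements are functions and not classes
  modulo null sets.
\<close>

definition sobolev_space :: "real \<Rightarrow> (real \<Rightarrow> real) set" where
  "sobolev_space s = {f. square_integrable f \<and>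
     (\<exists>g. is_fourier f g \<and> square_integrable (\<lambda>\<xi>. (1 + \<xi>\<^sup>2) powr (s / 2) *\<^sub>R g \<xi>))}"

definition sobolev_norm :: "real \<Rightarrow> (real \<Rightarrow> real) \<Rightarrow> real" where
  "sobolev_norm s f = sqrt (\<integral>\<xi>. (1 + \<xi>\<^sup>2) powr s * (norm (fourier f \<xi>))\<^sup>2 \<partial>lborel)"

text \<open>\<open>C(I; H\<^sup>s)\<close> and \<open>C\<^sup>1(I; H\<^sup>s)\<close>; at an endpoint of \<open>I\<close> the derivative is one-sided.\<close>

definition sobolev_C0 :: "real \<Rightarrow> real set \<Rightarrow> (real \<Rightarrow> real \<Rightarrow> real) \<Rightarrow> bool" where
  "sobolev_C0 s I u \<longleftrightarrow>
     (\<forall>t\<in>I. u t \<in> sobolev_space s) \<and>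
     (\<forall>t\<in>I. ((\<lambda>r. sobolev_norm s (\<lambda>x. u r x - u t x)) \<longlongrightarrow> 0) (at t within I))"

definition sobolev_C1 :: "real \<Rightarrow> real set \<Rightarrow> (real \<Rightarrow> real \<Rightarrow> real) \<Rightarrow> bool" where
  "sobolev_C1 s I u \<longleftrightarrow>
     (\<forall>t\<in>I. u t \<in> sobolev_space s) \<and>
     (\<exists>d. sobolev_C0 s I d \<and>
        (\<forall>t\<in>I. ((\<lambda>r. sobolev_norm s (\<lambda>x. (u r x - u t x) / (r - t) - d t x)) \<longlongrightarrow> 0)
           (at t within I)))"

definition has_compact_support :: "(real \<Rightarrow> real) \<Rightarrow> bool" where
  "has_compact_support f \<longleftrightarrow> compact (closure {x. f x \<noteq> 0})"

definition time_interval :: "ereal \<Rightarrow> real set" where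
  "time_interval T = {t. 0 \<le> t \<and> ereal t < T}"

text \<open>
  \<open>\<gamma> t x\<close> together with \<open>v t x\<close> is a classical solution on \<open>[0,T)\<close> of
    \<open>\<gamma>\<^sub>t = \<lambda> (v\<^sub>x - \<gamma> - v \<gamma> / \<lambda>)\<^sub>x\<close> for \<open>t > 0\<close>, \<open>v\<^sub>x\<^sub>x = \<gamma>\<^sub>x + \<gamma>\<^sup>2 / (2 \<lambda>)\<close> for \<open>t \<ge> 0\<close>, \<open>\<gamma> 0 = \<gamma>\<^sub>0\<close>;
  \<open>lam\<close> is the parameter \<open>\<lambda>\<close>. Here \<open>T\<close> may be infinite, and values at times outside \<open>[0,T)\<close>
  are irrelevant.
\<close>

definition classical_solution_pair ::
  "real \<Rightarrow> real \<Rightarrow> (real \<Rightarrow> real) \<Rightarrow> ereal \<Rightarrow> (real \<Rightarrow> real \<Rightarrow> real) \<Rightarrow> (real \<Rightarrow> real \<Rightarrow> real) \<Rightarrow> bool"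
where
  "classical_solution_pair lam s \<gamma>0 T \<gamma> v \<longleftrightarrow>
     0 < T \<and>
     sobolev_C0 s (time_interval T) \<gamma> \<and>
     sobolev_C1 (s - 1) (time_interval T) \<gamma> \<and>
     (\<exists>vx vxx.
        (\<forall>t\<in>time_interval T. \<forall>x. (v t has_real_derivative vx t x) (at x)) \<and>
        (\<forall>t\<in>time_interval T. \<forall>x. (vx t has_real_derivative vxx t x) (at x)) \<and>
        continuous_on (time_interval T \<times> UNIV) (\<lambda>(t, x). v t x) \<and>
        continuous_on (time_interval T \<times> UNIV) (\<lambda>(t, x). vx t x) \<and>
        continuous_on (time_interval T \<times> UNIV) (\<lambda>(t, x). vxx t x) \<and>
        (\<forall>t\<in>time_interval T. 0 < t \<longrightarrow> (\<forall>x. \<exists>D.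
           ((\<lambda>y. vx t y - \<gamma> t y - 1 / lam * v t y * \<gamma> t y) has_real_derivative D) (at x) \<and>
           ((\<lambda>r. \<gamma> r x) has_real_derivative lam * D) (at t))) \<and>
        (\<forall>t\<in>time_interval T. \<forall>x. \<exists>\<gamma>x.
           (\<gamma> t has_real_derivative \<gamma>x) (at x) \<and>
           vxx t x = \<gamma>x + (\<gamma> t x)\<^sup>2 / (2 * lam))) \<and>
     (\<forall>x. \<gamma> 0 x = \<gamma>0 x)"

definition classical_solution ::
  "real \<Rightarrow> real \<Rightarrow> (real \<Rightarrow> real) \<Rightarrow> ereal \<Rightarrow> (real \<Rightarrow> real \<Rightarrow> real) \<Rightarrow> bool"
where
  "classical_solution lam s \<gamma>0 T \<gamma> \<longleftrightarrow> (\<exists>v. classical_solution_pair lam s \<gamma>0 T \<gamma> v)"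

text \<open>
  \<open>T\<close> is the maximal existence time of \<open>\<gamma>\<close>: no solution with the same initial datum that agrees
  with \<open>\<gamma>\<close> on \<open>[0,T)\<close> lives on a longer interval.
\<close>

definition maximal_solution ::
  "real \<Rightarrow> real \<Rightarrow> (real \<Rightarrow> real) \<Rightarrow> ereal \<Rightarrow> (real \<Rightarrow> real \<Rightarrow> real) \<Rightarrow> bool"
where
  "maximal_solution lam s \<gamma>0 T \<gamma> \<longleftrightarrow>
     classical_solution lam s \<gamma>0 T \<gamma> \<and>
     \<not> (\<exists>T' \<gamma>'. T < T' \<and> classical_solution lam s \<gamma>0 T' \<gamma>' \<and>
          (\<forall>t\<in>time_interval T. \<forall>x. \<gamma>' t x = \<gamma> t x))"

end

theory Submission
  imports Defs "HOL-Probability.Characteristic_Functions"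
begin

text \<open>
  Expanding the equations gives the transport equation
  \<open>\<gamma>\<^sub>t + v \<gamma>\<^sub>x = (\<gamma> / 2 - v\<^sub>x) \<gamma>\<close>, so the support of \<open>\<gamma>\<close> is carried along by the velocity \<open>v\<close>. Nothing is
  assumed about \<open>v\<close> at infinity, but \<open>(v\<^sub>x - \<gamma>)\<^sub>x = \<gamma>\<^sup>2 / (2 \<lambda>)\<close> and \<open>\<gamma>\<close> is bounded in \<open>L\<^sup>2\<close> on compact time
  intervals, hence \<open>\<bar>v\<bar> \<le> A + B \<bar>x\<bar>\<close> there and the support stays bounded.

  Characteristics are avoided by a maximum principle: both
  \<open>exp (- M t) (1 + x\<^sup>2) - a\<close> and \<open>b - exp (M t) (1 + x\<^sup>2)\<close> decrease along the flow, so the product of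
  them with \<open>\<gamma>\<^sup>2\<close> and a decaying exponential has no positive maximum on the compact set where both
  are nonnegative. Continuity of \<open>\<gamma>\<close> in time with
  values in \<open>L\<^sup>2\<close> follows from an inequality of Plancherel type,
  obtained by averaging the squared modulus of the transform against wide Gaussians.
\<close>

subsection \<open>An inequality of Plancherel type\<close>

text \<open>Writing the squared modulus as \<open>F\<close> times its conjugate gives a double
  integral over \<open>x\<close> and \<open>y\<close>. Fubini moves the Gaussian average innermost,
  where it is the characteristic function of the standard normal law at
  \<open>- (a * (x - y))\<close>.\<close>

lemma gaussian_average_fourier:
  fixes u :: "real \<Rightarrow> real" and a R B :: real
  assumes [measurable]: "u \<in> borel_measurable borel"
    and bound: "\<And>x. \<bar>u x\<bar> \<le> B" and supp: "\<And>x. R < \<bar>x\<bar> \<Longrightarrow> u x = 0"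
  defines "F \<equiv> \<lambda>\<xi>. LINT x|lborel. complex_of_real (u x) * cis (- (x * \<xi>))"
  shows "(LINT \<zeta>|std_normal_distribution. (norm (F (a * \<zeta>)))\<^sup>2) =
    (LINT x|lborel. LINT y|lborel. u x * u y * exp (- (a * (x - y))\<^sup>2 / 2))"
proof -
  let ?N = "std_normal_distribution"
  interpret N: prob_space ?N by (rule prob_space_normal_density) simp
  interpret P: pair_sigma_finite ?N lborel by standard
  have B: "0 \<le> B" using bound[of 0] by linarith
  have [measurable_cong]: "sets ?N = sets borel" by simp
  have [measurable]: "F \<in> borel_measurable borel"
    unfolding F_def cis_conv_exp by measurable
  have [measurable]: "cnj \<in> borel_measurable borel"
    by (intro borel_measurable_continuous_onI continuous_intros)
  have int_u: "integrable lborel u"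
    using bound supp
    by (intro integrableI_bounded_set[where A = "{- R..R}" and B = B]) (auto simp: emeasure_lborel_Icc_eq)
  have F_bound: "norm (F \<xi>) \<le> (LINT x|lborel. \<bar>u x\<bar>)" for \<xi>
    unfolding F_def by (rule order_trans[OF integral_norm_bound]) (simp add: norm_mult)
  have cnj_F: "cnj (F \<xi>) = (LINT y|lborel. complex_of_real (u y) * cis (y * \<xi>))" for \<xi>
    unfolding F_def by (subst Bochner_Integration.integral_cnj[symmetric]) (simp add: cis_cnj del: Bochner_Integration.integral_cnj)
  \<comment> \<open>Integrability for both uses of Fubini: the integrand is at most
    \<open>L * B\<close> and vanishes unless \<open>x\<close> lies in \<open>{- R..R}\<close>, and
    the strip over that interval has finite measure because the Gaussian factor is a
    probability.\<close>
  have joint: "integrable (?N \<Otimes>\<^sub>M lborel) (case_prod h)"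
    if [measurable]: "case_prod h \<in> borel_measurable (?N \<Otimes>\<^sub>M lborel)"
      and h: "\<And>\<zeta> x. norm (h \<zeta> x) \<le> L * \<bar>u x\<bar>" "0 \<le> L"
    for h :: "real \<Rightarrow> real \<Rightarrow> complex" and L
  proof (rule integrableI_bounded_set[where A = "UNIV \<times> {- R..R}" and B = "L * B"])
    show "UNIV \<times> {- R..R} \<in> sets (?N \<Otimes>\<^sub>M lborel)" by (intro pair_measureI) auto
    show "case_prod h \<in> borel_measurable (?N \<Otimes>\<^sub>M lborel)" by fact
    have "emeasure ?N UNIV = 1" using N.emeasure_space_1 by simp
    then show "emeasure (?N \<Otimes>\<^sub>M lborel) (UNIV \<times> {- R..R}) < \<infinity>"
      by (subst lborel.emeasure_pair_measure_Times) (auto simp: emeasure_lborel_Icc_eq)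
    have "norm (h \<zeta> x) \<le> L * B" for \<zeta> x
      using h(1)[of \<zeta> x] mult_left_mono[OF bound h(2), of x] by linarith
    then show "AE z in ?N \<Otimes>\<^sub>M lborel. z \<in> UNIV \<times> {- R..R} \<longrightarrow> norm (case z of (\<zeta>, x) \<Rightarrow> h \<zeta> x) \<le> L * B"
      by auto
    have "h \<zeta> x = 0" if "x \<notin> {- R..R}" for \<zeta> x
      using h(1)[of \<zeta> x] supp[of x] that by auto
    then show "AE z in ?N \<Otimes>\<^sub>M lborel. z \<notin> UNIV \<times> {- R..R} \<longrightarrow> (case z of (\<zeta>, x) \<Rightarrow> h \<zeta> x) = 0"
      by (intro AE_I2) (auto simp: case_prod_beta mem_Times_iff)
  qed
  have char: "(LINT \<zeta>|?N. cis (s * \<zeta>)) = complex_of_real (exp (- s\<^sup>2 / 2))" for s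
    using char_std_normal_distribution[THEN fun_cong, of s]
    by (simp add: char_def cis_conv_exp mult_ac)
  have "complex_of_real (LINT \<zeta>|?N. (norm (F (a * \<zeta>)))\<^sup>2) =
      (LINT \<zeta>|?N. F (a * \<zeta>) * cnj (F (a * \<zeta>)))"
    by (simp only: integral_complex_of_real[symmetric] complex_norm_square)
  also have "\<dots> = (LINT \<zeta>|?N. LINT x|lborel. complex_of_real (u x) * cis (- (x * (a * \<zeta>))) * cnj (F (a * \<zeta>)))"
    unfolding F_def by simp
  also have "\<dots> = (LINT x|lborel. LINT \<zeta>|?N. complex_of_real (u x) * cis (- (x * (a * \<zeta>))) * cnj (F (a * \<zeta>)))"
  proof (rule P.Fubini_integral[symmetric], rule joint[of _ "LINT x|lborel. \<bar>u x\<bar>"])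
    show "(\<lambda>(\<zeta>, x). complex_of_real (u x) * cis (- (x * (a * \<zeta>))) * cnj (F (a * \<zeta>)))
      \<in> borel_measurable (?N \<Otimes>\<^sub>M lborel)"
      unfolding cis_conv_exp by measurable
    show "norm (complex_of_real (u x) * cis (- (x * (a * \<zeta>))) * cnj (F (a * \<zeta>)))
      \<le> (LINT x|lborel. \<bar>u x\<bar>) * \<bar>u x\<bar>" for \<zeta> x
      using mult_left_mono[OF F_bound, of "\<bar>u x\<bar>" "a * \<zeta>"] by (simp add: norm_mult mult.commute)
  qed simp
  also have "\<dots> = (LINT x|lborel. LINT y|lborel. complex_of_real (u x * u y * exp (- (a * (x - y))\<^sup>2 / 2)))"
  proof (rule Bochner_Integration.integral_cong[OF refl])
    fix x
    have "(LINT \<zeta>|?N. complex_of_real (u x) * cis (- (x * (a * \<zeta>))) * cnj (F (a * \<zeta>))) =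
       (LINT \<zeta>|?N. LINT y|lborel. complex_of_real (u x) * cis (- (x * (a * \<zeta>))) *
         (complex_of_real (u y) * cis (y * (a * \<zeta>))))"
      unfolding cnj_F by simp
    also have "\<dots> = (LINT y|lborel. LINT \<zeta>|?N. complex_of_real (u x) * cis (- (x * (a * \<zeta>))) *
         (complex_of_real (u y) * cis (y * (a * \<zeta>))))"
    proof (rule P.Fubini_integral[symmetric], rule joint[of _ "\<bar>u x\<bar>"])
      show "(\<lambda>(\<zeta>, y). complex_of_real (u x) * cis (- (x * (a * \<zeta>))) *
         (complex_of_real (u y) * cis (y * (a * \<zeta>)))) \<in> borel_measurable (?N \<Otimes>\<^sub>M lborel)"
        unfolding cis_conv_exp by measurable
    qed (simp_all add: norm_mult)
    also have "\<dots> = (LINT y|lborel. complex_of_real (u x * u y) * (LINT \<zeta>|?N. cis (- (a * (x - y)) * \<zeta>)))"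
      unfolding integral_mult_right_zero[symmetric]
      by (intro Bochner_Integration.integral_cong refl)
        (simp add: cis_mult[symmetric] algebra_simps, simp add: cis_mult algebra_simps)
    also have "\<dots> = (LINT y|lborel. complex_of_real (u x * u y * exp (- (a * (x - y))\<^sup>2 / 2)))"
      unfolding char by (simp add: power2_eq_square)
    finally show "(LINT \<zeta>|?N. complex_of_real (u x) * cis (- (x * (a * \<zeta>))) * cnj (F (a * \<zeta>))) = \<dots>" .
  qed
  also have "\<dots> = complex_of_real (LINT x|lborel. LINT y|lborel. u x * u y * exp (- (a * (x - y))\<^sup>2 / 2))"
    by (simp only: integral_complex_of_real)
  finally show ?thesis by (simp only: of_real_eq_iff)
qed

text \<open>Rescaled by \<open>Suc n\<close>, the Gaussian kernel is \<open>sqrt (2 * pi)\<close>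
  times an approximate identity, so the double integral tends to that multiple of the integral of
  \<open>u\<^sup>2\<close>. Using \<open>Suc n\<close> keeps the scale positive at
  \<open>n = 0\<close>.\<close>

lemma gaussian_convolution_tendsto:
  fixes u :: "real \<Rightarrow> real" and R B :: real
  assumes [measurable]: "u \<in> borel_measurable borel"
    and bound: "\<And>x. \<bar>u x\<bar> \<le> B" and supp: "\<And>x. R < \<bar>x\<bar> \<Longrightarrow> u x = 0"
    and cont: "\<And>x. \<bar>x\<bar> < R \<Longrightarrow> isCont u x"
  shows "(\<lambda>n. real (Suc n) *
      (LINT x|lborel. LINT y|lborel. u x * u y * exp (- (real (Suc n) * (x - y))\<^sup>2 / 2)))
    \<longlonglongrightarrow> sqrt (2 * pi) * (LINT x|lborel. (u x)\<^sup>2)"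
proof -
  let ?N = "std_normal_distribution"
  interpret N: prob_space ?N by (rule prob_space_normal_density) simp
  have B: "0 \<le> B" using bound[of 0] by linarith
  have [measurable_cong]: "sets ?N = sets borel" by simp
  have [simp]: "N.prob UNIV = 1" using N.prob_space by simp
  define J where "J n x = u x * (LINT z|?N. u (x + z / real (Suc n)))" for n x
  have [measurable]: "J n \<in> borel_measurable borel" for n
    unfolding J_def by measurable
  have J_le: "\<bar>J n x\<bar> \<le> B * B" for n x
  proof -
    have "\<bar>LINT z|?N. u (x + z / real (Suc n))\<bar> \<le> (LINT z|?N. B)"
      using bound by (intro integral_abs_bound_integral) (auto intro!: N.integrable_const_bound[where B = B])
    then show ?thesis
      using bound[of x] B by (auto simp: J_def abs_mult intro!: mult_mono)
  qed
  have scale: "real (Suc n) * (LINT x|lborel. LINT y|lborel. u x * u y * exp (- (real (Suc n) * (x - y))\<^sup>2 / 2))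
      = sqrt (2 * pi) * (LINT x|lborel. J n x)" for n
  proof -
    define a where "a = real (Suc n)"
    have a: "0 < a" by (simp add: a_def)
    \<comment> \<open>The substitution \<open>y = x + z / a\<close> turns the kernel into the
      standard normal density; its Jacobian \<open>1 / a\<close> cancels the prefactor
      \<open>a\<close>.\<close>
    have "(LINT y|lborel. u x * u y * exp (- (a * (x - y))\<^sup>2 / 2)) = (sqrt (2 * pi) / a) * J n x" for x
    proof -
      have integrand: "u x * u (x + (1 / a) * z) * exp (- (a * (x - (x + (1 / a) * z)))\<^sup>2 / 2) =
          sqrt (2 * pi) * u x * (std_normal_density z * u (x + z / a))" for z
        using a by (simp add: std_normal_density_def)
      have "(LINT y|lborel. u x * u y * exp (- (a * (x - y))\<^sup>2 / 2)) =
          \<bar>1 / a\<bar> *\<^sub>R (LINT z|lborel. u x * u (x + (1 / a) * z) * exp (- (a * (x - (x + (1 / a) * z)))\<^sup>2 / 2))"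
        using a by (intro lborel_integral_real_affine) auto
      also have "\<dots> = (1 / a) * (LINT z|lborel. sqrt (2 * pi) * u x * (std_normal_density z * u (x + z / a)))"
        unfolding integrand using a by simp
      also have "\<dots> = (1 / a) * (sqrt (2 * pi) * u x * (LINT z|lborel. std_normal_density z * u (x + z / a)))"
        by simp
      also have "(LINT z|lborel. std_normal_density z * u (x + z / a)) = (LINT z|?N. u (x + z / a))"
        by (subst integral_real_density) auto
      finally show ?thesis by (simp add: J_def a_def)
    qed
    then have "a * (LINT x|lborel. LINT y|lborel. u x * u y * exp (- (a * (x - y))\<^sup>2 / 2)) =
        sqrt (2 * pi) * (LINT x|lborel. J n x)"
      using a by simp
    then show ?thesis unfolding a_def .
  qed
  \<comment> \<open>At \<open>\<bar>x\<bar> = R\<close> the function may jump; these two points form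
    a null set.\<close>
  have inner: "(\<lambda>n. J n x) \<longlonglongrightarrow> (u x)\<^sup>2" if "\<bar>x\<bar> \<noteq> R" for x
  proof (cases "\<bar>x\<bar> < R")
    case True
    have "(\<lambda>n. LINT z|?N. u (x + z / real (Suc n))) \<longlonglongrightarrow> (LINT z|?N. u x)"
    proof (rule integral_dominated_convergence[where w = "\<lambda>_. B"])
      have "(\<lambda>n. x + z * (1 / real (Suc n))) \<longlonglongrightarrow> x + z * 0" for z :: real
        by (intro tendsto_intros LIMSEQ_inverse_real_of_nat[unfolded inverse_eq_divide])
      then have "(\<lambda>n. u (x + z / real (Suc n))) \<longlonglongrightarrow> u x" for z
        by (intro isCont_tendsto_compose[OF cont[OF True]]) simp
      then show "AE z in ?N. (\<lambda>n. u (x + z / real (Suc n))) \<longlonglongrightarrow> u x" by simp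
    qed (use bound in auto)
    then show ?thesis
      unfolding J_def power2_eq_square by (intro tendsto_mult tendsto_const) simp
  next
    case False
    then show ?thesis using supp[of x] that by (simp add: J_def)
  qed
  \<comment> \<open>The factor \<open>u x\<close> in \<open>J n x\<close> confines it to
    \<open>{- R..R}\<close>, so a multiple of the indicator dominates.\<close>
  have "(\<lambda>n. LINT x|lborel. J n x) \<longlonglongrightarrow> (LINT x|lborel. (u x)\<^sup>2)"
  proof (rule integral_dominated_convergence[where w = "\<lambda>x. B * B * indicator {- R..R} x"])
    have "AE x in lborel. x \<noteq> R \<and> x \<noteq> - R" using AE_lborel_singleton[of R] AE_lborel_singleton[of "- R"] by simp
    then show "AE x in lborel. (\<lambda>n. J n x) \<longlonglongrightarrow> (u x)\<^sup>2"
      by eventually_elim (rule inner, auto simp: abs_if split: if_splits)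
    show "AE x in lborel. norm (J n x) \<le> B * B * indicator {- R..R} x" for n
      using J_le supp by (auto simp: J_def indicator_def)
  qed (auto simp: emeasure_lborel_Icc_eq)
  then show ?thesis unfolding scale by (rule tendsto_mult_left)
qed

text \<open>The normal density is at most \<open>1 / sqrt (2 * pi)\<close>. After rescaling by
  \<open>Suc n\<close>, the Gaussian averages of the squared modulus are therefore bounded by the
  full integral divided by \<open>sqrt (2 * pi)\<close>, while by the two preceding lemmas they tend
  to \<open>sqrt (2 * pi)\<close> times the integral of \<open>u\<^sup>2\<close>.\<close>

lemma plancherel_compact_le:
  fixes u :: "real \<Rightarrow> real" and R B :: real
  assumes [measurable]: "u \<in> borel_measurable borel"
    and bound: "\<And>x. \<bar>u x\<bar> \<le> B" and supp: "\<And>x. R < \<bar>x\<bar> \<Longrightarrow> u x = 0"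
    and cont: "\<And>x. \<bar>x\<bar> < R \<Longrightarrow> isCont u x"
  shows "ennreal (2 * pi * (LINT x|lborel. (u x)\<^sup>2)) \<le>
    (\<integral>\<^sup>+ \<xi>. ennreal ((norm (LINT x|lborel. complex_of_real (u x) * cis (- (x * \<xi>))))\<^sup>2) \<partial>lborel)"
proof -
  let ?N = "std_normal_distribution"
  define F where "F \<xi> = (LINT x|lborel. complex_of_real (u x) * cis (- (x * \<xi>)))" for \<xi>
  have [measurable]: "F \<in> borel_measurable borel"
    unfolding F_def cis_conv_exp by measurable
  let ?I = "\<integral>\<^sup>+ \<xi>. ennreal ((norm (F \<xi>))\<^sup>2) \<partial>lborel"
  show ?thesis unfolding F_def[symmetric]
  proof (cases "?I = \<infinity>")
    case True
    then show "ennreal (2 * pi * (LINT x|lborel. (u x)\<^sup>2)) \<le> ?I" by simp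
  next
    case False
    then obtain I where I: "?I = ennreal I" "0 \<le> I" by (cases ?I) auto
    have le: "real (Suc n) * (LINT \<zeta>|?N. (norm (F (real (Suc n) * \<zeta>)))\<^sup>2) \<le> I / sqrt (2 * pi)" for n
    proof -
      define a where "a = real (Suc n)"
      have a: "0 < a" by (simp add: a_def)
      \<comment> \<open>In the non-integrable case the Bochner integral on the left is
        \<open>0\<close> by convention, and the bound is trivial.\<close>
      have "ennreal (LINT \<zeta>|?N. (norm (F (a * \<zeta>)))\<^sup>2) \<le> (\<integral>\<^sup>+ \<zeta>. ennreal ((norm (F (a * \<zeta>)))\<^sup>2) \<partial>?N)"
        by (cases "integrable ?N (\<lambda>\<zeta>. (norm (F (a * \<zeta>)))\<^sup>2)")
          (simp_all add: nn_integral_eq_integral not_integrable_integral_eq)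
      also have "\<dots> = (\<integral>\<^sup>+ \<zeta>. ennreal (std_normal_density \<zeta>) * ennreal ((norm (F (a * \<zeta>)))\<^sup>2) \<partial>lborel)"
        by (simp add: nn_integral_density)
      also have "\<dots> \<le> (\<integral>\<^sup>+ \<zeta>. ennreal (1 / sqrt (2 * pi)) * ennreal ((norm (F (a * \<zeta>)))\<^sup>2) \<partial>lborel)"
        by (intro nn_integral_mono mult_right_mono ennreal_leI)
          (auto simp: std_normal_density_def divide_right_mono)
      also have "\<dots> = ennreal (1 / sqrt (2 * pi)) * (\<integral>\<^sup>+ \<zeta>. ennreal ((norm (F (a * \<zeta>)))\<^sup>2) \<partial>lborel)"
        by (simp add: nn_integral_cmult)
      finally have 1: "ennreal (LINT \<zeta>|?N. (norm (F (a * \<zeta>)))\<^sup>2) \<le> \<dots>" .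
      have "ennreal (a * (LINT \<zeta>|?N. (norm (F (a * \<zeta>)))\<^sup>2)) =
          ennreal a * ennreal (LINT \<zeta>|?N. (norm (F (a * \<zeta>)))\<^sup>2)"
        using a by (intro ennreal_mult) auto
      also have "\<dots> \<le> ennreal a * (ennreal (1 / sqrt (2 * pi)) * (\<integral>\<^sup>+ \<zeta>. ennreal ((norm (F (a * \<zeta>)))\<^sup>2) \<partial>lborel))"
        by (intro mult_left_mono 1) auto
      also have "\<dots> = ennreal (1 / sqrt (2 * pi)) * (ennreal \<bar>a\<bar> * (\<integral>\<^sup>+ \<zeta>. ennreal ((norm (F (0 + a * \<zeta>)))\<^sup>2) \<partial>lborel))"
        using a by (simp add: mult_ac)
      also have "ennreal \<bar>a\<bar> * (\<integral>\<^sup>+ \<zeta>. ennreal ((norm (F (0 + a * \<zeta>)))\<^sup>2) \<partial>lborel) = ?I"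
        using a by (intro nn_integral_real_affine[symmetric]) auto
      also have "ennreal (1 / sqrt (2 * pi)) * ?I = ennreal (I / sqrt (2 * pi))"
        unfolding I using I(2) by (simp flip: ennreal_mult)
      finally show ?thesis using I(2) by (simp add: a_def)
    qed
    have "(\<lambda>n. real (Suc n) *
        (LINT x|lborel. LINT y|lborel. u x * u y * exp (- (real (Suc n) * (x - y))\<^sup>2 / 2)))
      \<longlonglongrightarrow> sqrt (2 * pi) * (LINT x|lborel. (u x)\<^sup>2)"
      using assms by (rule gaussian_convolution_tendsto)
    then have "sqrt (2 * pi) * (LINT x|lborel. (u x)\<^sup>2) \<le> I / sqrt (2 * pi)"
    proof (rule LIMSEQ_le_const2, intro exI allI impI)
      fix n
      show "real (Suc n) * (LINT x|lborel. LINT y|lborel. u x * u y * exp (- (real (Suc n) * (x - y))\<^sup>2 / 2))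
          \<le> I / sqrt (2 * pi)"
        using le[of n] gaussian_average_fourier[of u B R "real (Suc n)"] assms(1) bound supp
        unfolding F_def by simp
    qed
    then have "(LINT x|lborel. (u x)\<^sup>2) * (sqrt (2 * pi) * sqrt (2 * pi)) \<le> I"
      by (simp add: field_simps del: real_sqrt_mult_self)
    then have "2 * pi * (LINT x|lborel. (u x)\<^sup>2) \<le> I"
      by (simp add: mult.commute)
    then show "ennreal (2 * pi * (LINT x|lborel. (u x)\<^sup>2)) \<le> ?I"
      unfolding I by (rule ennreal_leI)
  qed
qed

section \<open>Linearity and almost everywhere uniqueness of the Fourier-Plancherel
  transform\<close>

lemma norm_diff_power2_le:
  fixes a b :: "'a::real_normed_vector"
  shows "(norm (a - b))\<^sup>2 \<le> 2 * (norm a)\<^sup>2 + 2 * (norm b)\<^sup>2"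
proof -
  have "(norm (a - b))\<^sup>2 \<le> (norm a + norm b)\<^sup>2"
    by (intro power_mono norm_triangle_ineq4) simp
  also have "\<dots> \<le> 2 * (norm a)\<^sup>2 + 2 * (norm b)\<^sup>2"
    using zero_le_power2[of "norm a - norm b"] by (simp add: power2_eq_square algebra_simps)
  finally show ?thesis .
qed

lemma square_integrable_diff:
  fixes f g :: "real \<Rightarrow> 'a::{real_normed_vector, second_countable_topology}"
  assumes "square_integrable f" "square_integrable g"
  shows "square_integrable (\<lambda>x. f x - g x)"
  unfolding square_integrable_def
proof
  have [measurable]: "f \<in> borel_measurable lborel" "g \<in> borel_measurable lborel"
    using assms by (auto simp: square_integrable_def)
  show "(\<lambda>x. f x - g x) \<in> borel_measurable lborel" by measurable
  show "integrable lborel (\<lambda>x. (norm (f x - g x))\<^sup>2)"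
  proof (rule Bochner_Integration.integrable_bound)
    show "integrable lborel (\<lambda>x. 2 * (norm (f x))\<^sup>2 + 2 * (norm (g x))\<^sup>2)"
      using assms by (auto simp: square_integrable_def)
  qed (use norm_diff_power2_le in auto)
qed

lemma borel_measurable_truncated_fourier:
  assumes "f \<in> borel_measurable lborel"
  shows "truncated_fourier f R \<in> borel_measurable borel"
proof -
  have [measurable]: "f \<in> borel_measurable borel" using assms by simp
  show ?thesis
    unfolding truncated_fourier_def[abs_def] set_lebesgue_integral_def cis_conv_exp by measurable
qed

lemma truncated_fourier_diff:
  assumes "square_integrable f1" "square_integrable f2"
  shows "truncated_fourier (\<lambda>x. f1 x - f2 x) R \<xi> = truncated_fourier f1 R \<xi> - truncated_fourier f2 R \<xi>"
proof -
  \<comment> \<open>Splitting the integral needs integrability of both parts. On a bounded interval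
    it follows from square integrability through
    \<open>\<bar>y\<bar> \<le> 1 + y\<^sup>2\<close>.\<close>
  have "set_integrable lborel {- R..R} (\<lambda>x. complex_of_real (f x) * cis (- (x * \<xi>)))"
    if f: "square_integrable f" for f
  proof -
    have [measurable]: "f \<in> borel_measurable borel" using f by (simp add: square_integrable_def)
    show ?thesis
      unfolding set_integrable_def
    proof (rule Bochner_Integration.integrable_bound)
      show "integrable lborel (\<lambda>x. indicator {- R..R} x + (norm (f x))\<^sup>2)"
        using f by (intro Bochner_Integration.integrable_add)
          (auto simp: square_integrable_def emeasure_lborel_Icc_eq)
      show "(\<lambda>x. indicator {- R..R} x *\<^sub>R (complex_of_real (f x) * cis (- (x * \<xi>)))) \<in> borel_measurable lborel"
        unfolding cis_conv_exp by measurable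
      have "\<bar>y\<bar> \<le> 1 + y\<^sup>2" for y :: real
        using zero_le_power2[of "\<bar>y\<bar> - 1"] zero_le_power2[of y] by (simp add: power2_diff)
      then show "AE x in lborel. norm (indicator {- R..R} x *\<^sub>R (complex_of_real (f x) * cis (- (x * \<xi>))))
          \<le> norm (indicator {- R..R} x + (norm (f x))\<^sup>2)"
        by (auto simp: norm_mult indicator_def intro: order_trans)
    qed
  qed
  from this[OF assms(1)] this[OF assms(2)] show ?thesis
    unfolding truncated_fourier_def
    by (subst set_integral_diff(2)[symmetric]) (auto simp: left_diff_distrib)
qed

lemma nn_integral_norm_diff_le:
  fixes f g :: "real \<Rightarrow> complex"
  assumes [measurable]: "f \<in> borel_measurable lborel" "g \<in> borel_measurable lborel"
  shows "(\<integral>\<^sup>+ x. ennreal ((norm (f x - g x))\<^sup>2) \<partial>lborel) \<le>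
    2 * (\<integral>\<^sup>+ x. ennreal ((norm (f x))\<^sup>2) \<partial>lborel) + 2 * (\<integral>\<^sup>+ x. ennreal ((norm (g x))\<^sup>2) \<partial>lborel)"
proof -
  have [measurable]: "f \<in> borel_measurable borel" "g \<in> borel_measurable borel"
    using assms by simp_all
  have "(\<integral>\<^sup>+ x. ennreal ((norm (f x - g x))\<^sup>2) \<partial>lborel) \<le>
      (\<integral>\<^sup>+ x. 2 * ennreal ((norm (f x))\<^sup>2) + 2 * ennreal ((norm (g x))\<^sup>2) \<partial>lborel)"
  proof (rule nn_integral_mono)
    fix x
    have "ennreal ((norm (f x - g x))\<^sup>2) \<le> ennreal (2 * (norm (f x))\<^sup>2 + 2 * (norm (g x))\<^sup>2)"
      by (intro ennreal_leI norm_diff_power2_le)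
    also have "\<dots> = 2 * ennreal ((norm (f x))\<^sup>2) + 2 * ennreal ((norm (g x))\<^sup>2)"
      by (simp add: ennreal_mult)
    finally show "ennreal ((norm (f x - g x))\<^sup>2) \<le> \<dots>" .
  qed
  also have "\<dots> = 2 * (\<integral>\<^sup>+ x. ennreal ((norm (f x))\<^sup>2) \<partial>lborel) + 2 * (\<integral>\<^sup>+ x. ennreal ((norm (g x))\<^sup>2) \<partial>lborel)"
    by (simp add: nn_integral_add nn_integral_cmult)
  finally show ?thesis .
qed

lemma tendsto_add_double_zero:
  fixes A B :: "real \<Rightarrow> ennreal"
  assumes "(A \<longlongrightarrow> 0) F" "(B \<longlongrightarrow> 0) F"
  shows "((\<lambda>R. 2 * A R + 2 * B R) \<longlongrightarrow> 0) F"
proof -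
  have "((\<lambda>R. 2 * A R + 2 * B R) \<longlongrightarrow> 2 * 0 + 2 * 0) F"
    using assms by (intro tendsto_add ennreal_tendsto_cmult) auto
  then show ?thesis by simp
qed

text \<open>Truncated transforms subtract exactly, so the mean-square error of the difference is at
  most twice the sum of the two errors.\<close>

lemma is_fourier_diff:
  assumes f: "square_integrable f1" "square_integrable f2"
    and g: "is_fourier f1 g1" "is_fourier f2 g2"
  shows "is_fourier (\<lambda>x. f1 x - f2 x) (\<lambda>\<xi>. g1 \<xi> - g2 \<xi>)"
  unfolding is_fourier_def
proof
  have sq: "square_integrable g1" "square_integrable g2" using g by (auto simp: is_fourier_def)
  show "square_integrable (\<lambda>\<xi>. g1 \<xi> - g2 \<xi>)" using sq by (rule square_integrable_diff)
  have [measurable]: "g1 \<in> borel_measurable borel" "g2 \<in> borel_measurable borel"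
      "truncated_fourier f1 R \<in> borel_measurable borel" "truncated_fourier f2 R \<in> borel_measurable borel" for R
    using sq f borel_measurable_truncated_fourier by (auto simp: square_integrable_def)
  let ?E = "\<lambda>f g R. \<integral>\<^sup>+ \<xi>. ennreal ((norm (truncated_fourier f R \<xi> - g \<xi>))\<^sup>2) \<partial>lborel"
  have le: "?E (\<lambda>x. f1 x - f2 x) (\<lambda>\<xi>. g1 \<xi> - g2 \<xi>) R \<le> 2 * ?E f1 g1 R + 2 * ?E f2 g2 R" for R
  proof -
    have "?E (\<lambda>x. f1 x - f2 x) (\<lambda>\<xi>. g1 \<xi> - g2 \<xi>) R = (\<integral>\<^sup>+ \<xi>. ennreal ((norm
        ((truncated_fourier f1 R \<xi> - g1 \<xi>) - (truncated_fourier f2 R \<xi> - g2 \<xi>)))\<^sup>2) \<partial>lborel)"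
      unfolding truncated_fourier_diff[OF f] by (simp add: algebra_simps)
    also have "\<dots> \<le> 2 * ?E f1 g1 R + 2 * ?E f2 g2 R"
      by (rule nn_integral_norm_diff_le) measurable
    finally show ?thesis .
  qed
  show "(?E (\<lambda>x. f1 x - f2 x) (\<lambda>\<xi>. g1 \<xi> - g2 \<xi>) \<longlongrightarrow> 0) at_top"
    by (rule tendsto_sandwich[OF _ _ tendsto_const tendsto_add_double_zero[of "?E f1 g1" _ "?E f2 g2"]])
      (use g le in \<open>auto simp: is_fourier_def\<close>)
qed

text \<open>The distance of \<open>g1\<close> and \<open>g2\<close> does not depend on
  \<open>R\<close> but is bounded by errors that tend to 0. This allows the arbitrary choice made in
  \<open>fourier\<close> to be exchanged for any known transform under an integral.\<close>

lemma is_fourier_unique: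
  assumes f: "square_integrable f" and g: "is_fourier f g1" "is_fourier f g2"
  shows "AE \<xi> in lborel. g1 \<xi> = g2 \<xi>"
proof -
  have sq: "square_integrable g1" "square_integrable g2" using g by (auto simp: is_fourier_def)
  have [measurable]: "g1 \<in> borel_measurable borel" "g2 \<in> borel_measurable borel"
      "truncated_fourier f R \<in> borel_measurable borel" for R
    using sq f borel_measurable_truncated_fourier by (auto simp: square_integrable_def)
  let ?E = "\<lambda>g R. \<integral>\<^sup>+ \<xi>. ennreal ((norm (truncated_fourier f R \<xi> - g \<xi>))\<^sup>2) \<partial>lborel"
  let ?D = "\<integral>\<^sup>+ \<xi>. ennreal ((norm (g1 \<xi> - g2 \<xi>))\<^sup>2) \<partial>lborel"
  have le: "?D \<le> 2 * ?E g2 R + 2 * ?E g1 R" for R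
    using nn_integral_norm_diff_le[of "\<lambda>\<xi>. truncated_fourier f R \<xi> - g2 \<xi>" "\<lambda>\<xi>. truncated_fourier f R \<xi> - g1 \<xi>"]
    by simp
  have "((\<lambda>R. 2 * ?E g2 R + 2 * ?E g1 R) \<longlongrightarrow> 0) at_top"
    by (rule tendsto_add_double_zero) (use g in \<open>auto simp: is_fourier_def\<close>)
  then have "?D \<le> 0"
    by (rule tendsto_lowerbound) (use le in auto)
  then have "AE \<xi> in lborel. ennreal ((norm (g1 \<xi> - g2 \<xi>))\<^sup>2) = 0"
    by (subst nn_integral_0_iff_AE[symmetric]) auto
  then show ?thesis by eventually_elim simp
qed

section \<open>Passage from truncations to the whole line and to Sobolev norms\<close>

text \<open>The compactly supported case applies to \<open>f\<close> cut off to
  \<open>{- R..R}\<close>, whose transform is exactly \<open>truncated_fourier f R\<close>; then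
  \<open>R\<close> tends to infinity. Continuity of \<open>f\<close> makes the cut-off bounded, and
  continuous inside the interval.\<close>

lemma plancherel_le:
  assumes cont: "continuous_on UNIV f" and f: "square_integrable f" and g: "is_fourier f g"
  shows "(LINT x|lborel. (f x)\<^sup>2) \<le> (LINT \<xi>|lborel. (norm (g \<xi>))\<^sup>2)"
proof -
  have sq: "square_integrable g" using g by (auto simp: is_fourier_def)
  have [measurable]: "f \<in> borel_measurable borel" "g \<in> borel_measurable borel"
      "truncated_fourier f R \<in> borel_measurable borel" for R
    using sq f borel_measurable_truncated_fourier by (auto simp: square_integrable_def)
  define u where "u R x = indicator {- R..R} x * f x" for R x
  let ?E = "\<lambda>R. \<integral>\<^sup>+ \<xi>. ennreal ((norm (truncated_fourier f R \<xi> - g \<xi>))\<^sup>2) \<partial>lborel"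
  let ?G = "\<integral>\<^sup>+ \<xi>. ennreal ((norm (g \<xi>))\<^sup>2) \<partial>lborel"
  have le: "ennreal (2 * pi * (LINT x|lborel. (u R x)\<^sup>2)) \<le> 2 * ?E R + 2 * ?G" for R
  proof -
    have "compact (f ` {- R..R})"
      using cont by (intro compact_continuous_image) (auto intro: continuous_on_subset)
    then obtain B where B: "\<forall>y\<in>f ` {- R..R}. norm y \<le> B"
      using compact_imp_bounded bounded_iff by blast
    have "ennreal (2 * pi * (LINT x|lborel. (u R x)\<^sup>2)) \<le>
      (\<integral>\<^sup>+ \<xi>. ennreal ((norm (LINT x|lborel. complex_of_real (u R x) * cis (- (x * \<xi>))))\<^sup>2) \<partial>lborel)"
    proof (rule plancherel_compact_le)
      show "u R \<in> borel_measurable borel" unfolding u_def by measurable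
      show "\<bar>u R x\<bar> \<le> \<bar>B\<bar>" for x using B by (force simp: u_def indicator_def intro: order_trans[OF _ abs_ge_self])
      show "u R x = 0" if "R < \<bar>x\<bar>" for x using that by (auto simp: u_def indicator_def)
      show "isCont (u R) x" if "\<bar>x\<bar> < R" for x
      proof -
        have "\<forall>\<^sub>F y in nhds x. y \<in> {- R<..<R}"
          using that by (intro eventually_nhds_in_open) auto
        then have "\<forall>\<^sub>F y in nhds x. u R y = f y"
          by eventually_elim (auto simp: u_def)
        then show ?thesis
          using cont isCont_cong by (auto simp: continuous_on_eq_continuous_at)
      qed
    qed
    also have "\<dots> = (\<integral>\<^sup>+ \<xi>. ennreal ((norm (truncated_fourier f R \<xi>))\<^sup>2) \<partial>lborel)"
      by (simp add: truncated_fourier_def set_lebesgue_integral_def u_def scaleR_conv_of_real mult_ac)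
    \<comment> \<open>The truncated transform is the difference of its error and
      \<open>- g\<close>.\<close>
    also have "\<dots> \<le> 2 * ?E R + 2 * ?G"
      using nn_integral_norm_diff_le[of "\<lambda>\<xi>. truncated_fourier f R \<xi> - g \<xi>" "\<lambda>\<xi>. - g \<xi>"] by simp
    finally show ?thesis .
  qed
  have "((\<lambda>R. LINT x|lborel. (u R x)\<^sup>2) \<longlongrightarrow> (LINT x|lborel. (f x)\<^sup>2)) at_top"
  proof (rule integral_dominated_convergence_at_top[where w = "\<lambda>x. (f x)\<^sup>2"])
    show "integrable lborel (\<lambda>x. (f x)\<^sup>2)" using f by (simp add: square_integrable_def)
    show "\<forall>\<^sub>F R in at_top. AE x in lborel. norm ((u R x)\<^sup>2) \<le> (f x)\<^sup>2"
      by (auto simp: u_def indicator_def)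
    show "AE x in lborel. ((\<lambda>R. (u R x)\<^sup>2) \<longlongrightarrow> (f x)\<^sup>2) at_top"
    proof (rule AE_I2)
      fix x
      have "\<forall>\<^sub>F R in at_top. (f x)\<^sup>2 = (u R x)\<^sup>2"
        using eventually_ge_at_top[of "\<bar>x\<bar>"] by eventually_elim (auto simp: u_def indicator_def)
      then show "((\<lambda>R. (u R x)\<^sup>2) \<longlongrightarrow> (f x)\<^sup>2) at_top"
        by (rule Lim_transform_eventually[OF tendsto_const])
    qed
  qed (auto simp: u_def)
  then have lim_u: "((\<lambda>R. ennreal (2 * pi * (LINT x|lborel. (u R x)\<^sup>2))) \<longlongrightarrow>
      ennreal (2 * pi * (LINT x|lborel. (f x)\<^sup>2))) at_top"
    by (intro tendsto_ennrealI tendsto_mult_left)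
  have lim_E: "((\<lambda>R. 2 * ?E R + 2 * ?G) \<longlongrightarrow> 2 * 0 + 2 * ?G) at_top"
    using g by (intro tendsto_add ennreal_tendsto_cmult tendsto_const) (auto simp: is_fourier_def)
  have "ennreal (2 * pi * (LINT x|lborel. (f x)\<^sup>2)) \<le> 2 * 0 + 2 * ?G"
    by (rule tendsto_le[OF trivial_limit_at_top_linorder lim_E lim_u]) (intro always_eventually allI le)
  also have "?G = ennreal (LINT \<xi>|lborel. (norm (g \<xi>))\<^sup>2)"
    using sq by (intro nn_integral_eq_integral) (auto simp: square_integrable_def)
  also have "2 * 0 + 2 * \<dots> = ennreal (2 * (LINT \<xi>|lborel. (norm (g \<xi>))\<^sup>2))"
    by (simp add: ennreal_mult)
  finally have "2 * pi * (LINT x|lborel. (f x)\<^sup>2) \<le> 2 * (LINT \<xi>|lborel. (norm (g \<xi>))\<^sup>2)"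
    by (subst (asm) ennreal_le_iff) auto
  \<comment> \<open>The factor 2 lost in splitting off the error is balanced by the
    \<open>2 * pi\<close> on the left; the remaining \<open>pi\<close> is at least 1.\<close>
  moreover have "1 * (LINT x|lborel. (f x)\<^sup>2) \<le> pi * (LINT x|lborel. (f x)\<^sup>2)"
    using pi_gt3 by (intro mult_right_mono) auto
  ultimately show ?thesis by simp
qed

lemma sobolev_space_diff:
  assumes "f1 \<in> sobolev_space s" "f2 \<in> sobolev_space s"
  shows "(\<lambda>x. f1 x - f2 x) \<in> sobolev_space s"
proof -
  obtain g1 g2 where g: "is_fourier f1 g1" "is_fourier f2 g2"
      and w: "square_integrable (\<lambda>\<xi>. (1 + \<xi>\<^sup>2) powr (s / 2) *\<^sub>R g1 \<xi>)"
        "square_integrable (\<lambda>\<xi>. (1 + \<xi>\<^sup>2) powr (s / 2) *\<^sub>R g2 \<xi>)"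
    using assms by (auto simp: sobolev_space_def)
  have f: "square_integrable f1" "square_integrable f2"
    using assms by (auto simp: sobolev_space_def)
  have "square_integrable (\<lambda>\<xi>. (1 + \<xi>\<^sup>2) powr (s / 2) *\<^sub>R (g1 \<xi> - g2 \<xi>))"
    using square_integrable_diff[OF w] by (simp add: scaleR_right_diff_distrib)
  with is_fourier_diff[OF f g] square_integrable_diff[OF f] show ?thesis
    by (auto simp: sobolev_space_def)
qed

text \<open>For \<open>0 \<le> s\<close> the weight \<open>(1 + \<xi>\<^sup>2) powr s\<close> is at
  least 1. The comparison is made with the transform \<open>g\<close> supplied by membership in the
  space, whose weighted square is integrable, and is then carried over to
  \<open>fourier f\<close>.\<close>

lemma L2_le_sobolev_norm:
  assumes s: "0 \<le> s" and cont: "continuous_on UNIV f" and f: "f \<in> sobolev_space s"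
  shows "(LINT x|lborel. (f x)\<^sup>2) \<le> (sobolev_norm s f)\<^sup>2"
proof -
  have sq: "square_integrable f" using f by (simp add: sobolev_space_def)
  obtain g where g: "is_fourier f g"
      and w: "square_integrable (\<lambda>\<xi>. (1 + \<xi>\<^sup>2) powr (s / 2) *\<^sub>R g \<xi>)"
    using f by (auto simp: sobolev_space_def)
  have sqg: "square_integrable g" using g by (simp add: is_fourier_def)
  have fo: "is_fourier f (fourier f)"
    using someI[of "is_fourier f", OF g] by (simp add: fourier_def)
  have [measurable]: "g \<in> borel_measurable borel" "fourier f \<in> borel_measurable borel"
    using g fo by (auto simp: is_fourier_def square_integrable_def)
  have w_eq: "(norm ((1 + \<xi>\<^sup>2) powr (s / 2) *\<^sub>R g \<xi>))\<^sup>2 = (1 + \<xi>\<^sup>2) powr s * (norm (g \<xi>))\<^sup>2" for \<xi>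
    by (simp add: power_mult_distrib power2_eq_square flip: powr_add)
  have int_w: "integrable lborel (\<lambda>\<xi>. (1 + \<xi>\<^sup>2) powr s * (norm (g \<xi>))\<^sup>2)"
    using w unfolding square_integrable_def w_eq by simp
  have "(LINT x|lborel. (f x)\<^sup>2) \<le> (LINT \<xi>|lborel. (norm (g \<xi>))\<^sup>2)"
    using cont sq g by (rule plancherel_le)
  also have "\<dots> \<le> (LINT \<xi>|lborel. (1 + \<xi>\<^sup>2) powr s * (norm (g \<xi>))\<^sup>2)"
  proof (rule integral_mono[OF _ int_w])
    show "integrable lborel (\<lambda>\<xi>. (norm (g \<xi>))\<^sup>2)"
      using sqg by (simp add: square_integrable_def)
    show "(norm (g \<xi>))\<^sup>2 \<le> (1 + \<xi>\<^sup>2) powr s * (norm (g \<xi>))\<^sup>2" for \<xi>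
      using mult_right_mono[of 1 "(1 + \<xi>\<^sup>2) powr s" "(norm (g \<xi>))\<^sup>2"] s
      by (simp add: ge_one_powr_ge_zero)
  qed
  also have "\<dots> = (LINT \<xi>|lborel. (1 + \<xi>\<^sup>2) powr s * (norm (fourier f \<xi>))\<^sup>2)"
    using is_fourier_unique[OF sq g fo] by (intro integral_cong_AE) auto
  also have "\<dots> = (sobolev_norm s f)\<^sup>2"
    unfolding sobolev_norm_def by (subst real_sqrt_pow2) (auto intro: Bochner_Integration.integral_nonneg)
  finally show ?thesis .
qed

subsection \<open>Consequences of the elliptic equation\<close>

text \<open>Integrating the derivative, the constant contributes the length of the interval and
  \<open>w\<close> at most its integral over the whole line, whatever \<open>x\<close> is. The gauge
  integral serves here because \<open>k\<close> is a mere pointwise derivative, not known to be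
  continuous.\<close>

lemma increment_bound:
  fixes \<phi> k w :: "real \<Rightarrow> real"
  assumes deriv: "\<And>y. (\<phi> has_real_derivative k y) (at y)"
    and bound: "\<And>y. \<bar>k y\<bar> \<le> C + w y"
    and int: "integrable lborel w" and nonneg: "\<And>y. 0 \<le> w y"
  shows "\<bar>\<phi> x - \<phi> 0\<bar> \<le> C * \<bar>x\<bar> + (LINT y|lborel. w y)"
proof -
  have *: "\<bar>\<phi> b - \<phi> a\<bar> \<le> C * (b - a) + (LINT y|lborel. w y)" if "a \<le> b" for a b
  proof -
    have k: "(k has_integral (\<phi> b - \<phi> a)) {a..b}"
      using \<open>a \<le> b\<close> deriv
      by (intro fundamental_theorem_of_calculus)
        (auto simp: has_real_derivative_iff_has_vector_derivative[symmetric] intro: has_field_derivative_at_within)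
    have wU: "(w has_integral (LINT y|lborel. w y)) UNIV"
      using int by (rule has_integral_integral_lborel)
    then have w: "w integrable_on {a..b}"
      by (intro integrable_on_subinterval[of w UNIV]) auto
    have "norm (integral {a..b} k) \<le> integral {a..b} (\<lambda>y. C + w y)"
      using k w bound
      by (intro Henstock_Kurzweil_Integration.integral_norm_bound_integral Henstock_Kurzweil_Integration.integrable_add)
        auto
    also have "\<dots> = C * (b - a) + integral {a..b} w"
      using w \<open>a \<le> b\<close> by (subst Henstock_Kurzweil_Integration.integral_add) auto
    also have "integral {a..b} w \<le> integral UNIV w"
      using w wU nonneg by (intro integral_subset_le) auto
    also have "integral UNIV w = (LINT y|lborel. w y)"
      using wU by (rule integral_unique)
    finally show ?thesis using integral_unique[OF k] by simp
  qed
  show ?thesis using *[of 0 x] *[of x 0] by (cases "0 \<le> x") (auto simp: abs_minus_commute)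
qed

section \<open>Squares under mean-square convergence, and joint continuity\<close>

text \<open>Expand around \<open>b\<close> and apply the weighted Young inequality to the cross
  term. The parameter \<open>\<eta>\<close> is fixed first, to make the \<open>b\<close> term small;
  the difference is made small afterwards.\<close>

lemma abs_power2_diff_le:
  fixes a b \<eta> :: real
  assumes "0 < \<eta>"
  shows "\<bar>a\<^sup>2 - b\<^sup>2\<bar> \<le> (1 + 1 / \<eta>) * (a - b)\<^sup>2 + \<eta> * b\<^sup>2"
proof -
  have "2 * \<bar>a - b\<bar> * (\<eta> * \<bar>b\<bar>) \<le> (a - b)\<^sup>2 + (\<eta> * b)\<^sup>2"
    using sum_squares_bound[of "\<bar>a - b\<bar>" "\<eta> * \<bar>b\<bar>"] by (simp add: power_mult_distrib)
  then have "2 * \<bar>a - b\<bar> * \<bar>b\<bar> \<le> (a - b)\<^sup>2 / \<eta> + \<eta> * b\<^sup>2"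
    using assms by (simp add: field_simps power2_eq_square)
  moreover have "\<bar>a\<^sup>2 - b\<^sup>2\<bar> \<le> (a - b)\<^sup>2 + 2 * \<bar>a - b\<bar> * \<bar>b\<bar>"
  proof -
    have "a\<^sup>2 - b\<^sup>2 = (a - b)\<^sup>2 + 2 * (a - b) * b" by (simp add: power2_eq_square algebra_simps)
    then show ?thesis using abs_triangle_ineq[of "(a - b)\<^sup>2" "2 * (a - b) * b"]
      by (simp only: abs_mult abs_numeral abs_power2)
  qed
  ultimately show ?thesis by (simp add: algebra_simps)
qed

text \<open>Mean-square convergence makes the squares converge in the mean. The explicit majorant
  \<open>w\<close> is kept because it is also what \<open>increment_bound\<close> asks for.\<close>

lemma eventually_square_diff_dominated:
  fixes u :: "'i \<Rightarrow> real \<Rightarrow> real"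
  assumes f: "square_integrable f" and u: "\<forall>\<^sub>F r in F. square_integrable (u r)"
    and lim: "((\<lambda>r. LINT x|lborel. (u r x - f x)\<^sup>2) \<longlongrightarrow> 0) F" and "0 < \<epsilon>"
  shows "\<forall>\<^sub>F r in F. \<exists>w. integrable lborel w \<and> (\<forall>x. 0 \<le> w x) \<and>
    (\<forall>x. \<bar>(u r x)\<^sup>2 - (f x)\<^sup>2\<bar> \<le> w x) \<and> (LINT x|lborel. w x) < \<epsilon>"
proof -
  define N where "N = (LINT x|lborel. (f x)\<^sup>2)"
  have N: "0 \<le> N" by (simp add: N_def)
  \<comment> \<open>The summand 1 avoids a division by zero and makes
    \<open>\<eta> * N < \<epsilon> / 2\<close> strict.\<close>
  define \<eta> where "\<eta> = \<epsilon> / (2 * (N + 1))"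
  have \<eta>: "0 < \<eta>" using N \<open>0 < \<epsilon>\<close> by (simp add: \<eta>_def)
  have \<eta>N: "\<eta> * N < \<epsilon> / 2" using N \<open>0 < \<epsilon>\<close> by (simp add: \<eta>_def field_simps)
  have "((\<lambda>r. (1 + 1 / \<eta>) * (LINT x|lborel. (u r x - f x)\<^sup>2)) \<longlongrightarrow> (1 + 1 / \<eta>) * 0) F"
    using lim by (rule tendsto_mult_left)
  then have "\<forall>\<^sub>F r in F. (1 + 1 / \<eta>) * (LINT x|lborel. (u r x - f x)\<^sup>2) < \<epsilon> / 2"
    using \<open>0 < \<epsilon>\<close> by (intro order_tendstoD(2)) auto
  with u show ?thesis
  proof eventually_elim
    case (elim r)
    define w where "w x = (1 + 1 / \<eta>) * (u r x - f x)\<^sup>2 + \<eta> * (f x)\<^sup>2" for x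
    have int: "integrable lborel (\<lambda>x. (u r x - f x)\<^sup>2)" "integrable lborel (\<lambda>x. (f x)\<^sup>2)"
      using square_integrable_diff[OF elim(1) f] f by (auto simp: square_integrable_def)
    then have "(LINT x|lborel. w x) = (1 + 1 / \<eta>) * (LINT x|lborel. (u r x - f x)\<^sup>2) + \<eta> * N"
      by (simp add: w_def N_def)
    also have "\<dots> < \<epsilon>"
      using add_strict_mono[OF elim(2) \<eta>N] by (simp only: field_sum_of_halves)
    finally have "(LINT x|lborel. w x) < \<epsilon>" .
    moreover have "integrable lborel w" using int by (simp add: w_def[abs_def])
    moreover have "0 \<le> w x" for x using \<eta> by (simp add: w_def)
    moreover have "\<bar>(u r x)\<^sup>2 - (f x)\<^sup>2\<bar> \<le> w x" for x
      unfolding w_def using \<eta> by (rule abs_power2_diff_le)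
    ultimately show ?case by blast
  qed
qed

lemma tendsto_L2_square:
  fixes u :: "'i \<Rightarrow> real \<Rightarrow> real"
  assumes f: "square_integrable f" and u: "\<forall>\<^sub>F r in F. square_integrable (u r)"
    and lim: "((\<lambda>r. LINT x|lborel. (u r x - f x)\<^sup>2) \<longlongrightarrow> 0) F"
  shows "((\<lambda>r. LINT x|lborel. (u r x)\<^sup>2) \<longlongrightarrow> (LINT x|lborel. (f x)\<^sup>2)) F"
proof (rule tendstoI)
  fix \<epsilon> :: real assume "0 < \<epsilon>"
  show "\<forall>\<^sub>F r in F. dist (LINT x|lborel. (u r x)\<^sup>2) (LINT x|lborel. (f x)\<^sup>2) < \<epsilon>"
    using eventually_square_diff_dominated[OF assms \<open>0 < \<epsilon>\<close>] u
  proof eventually_elim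
    case (elim r)
    then obtain w where w: "integrable lborel w" "\<And>x. \<bar>(u r x)\<^sup>2 - (f x)\<^sup>2\<bar> \<le> w x" "(LINT x|lborel. w x) < \<epsilon>"
      by blast
    have int: "integrable lborel (\<lambda>x. (u r x)\<^sup>2)" "integrable lborel (\<lambda>x. (f x)\<^sup>2)"
      using elim(2) f by (auto simp: square_integrable_def)
    then have "\<bar>(LINT x|lborel. (u r x)\<^sup>2) - (LINT x|lborel. (f x)\<^sup>2)\<bar> = \<bar>LINT x|lborel. (u r x)\<^sup>2 - (f x)\<^sup>2\<bar>"
      by simp
    also have "\<dots> \<le> (LINT x|lborel. w x)"
      using int w by (intro integral_abs_bound_integral) auto
    finally show ?case using w(3) by (simp add: dist_real_def)
  qed
qed

text \<open>Move first in time, uniformly in space, and then in space at the fixed time; each move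
  costs half of \<open>\<epsilon>\<close>.\<close>

lemma continuous_on_Times_uniform_limit:
  fixes G :: "'a::metric_space \<Rightarrow> 'b::metric_space \<Rightarrow> 'c::metric_space"
  assumes unif: "\<And>t. t \<in> I \<Longrightarrow> uniform_limit UNIV G (G t) (at t within I)"
    and cont: "\<And>t. t \<in> I \<Longrightarrow> continuous_on UNIV (G t)"
  shows "continuous_on (I \<times> UNIV) (\<lambda>(t, x). G t x)"
  unfolding continuous_on_iff
proof (intro ballI allI impI)
  fix z and \<epsilon> :: real assume z: "z \<in> I \<times> (UNIV :: 'b set)" and "0 < \<epsilon>"
  then obtain t x where tx: "z = (t, x)" "t \<in> I" by auto
  obtain d1 where d1: "0 < d1" "\<And>r y. r \<in> I \<Longrightarrow> dist r t < d1 \<Longrightarrow> dist (G r y) (G t y) < \<epsilon> / 2"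
  proof -
    have "\<forall>\<^sub>F r in at t within I. \<forall>y\<in>UNIV. dist (G r y) (G t y) < \<epsilon> / 2"
      using unif[OF tx(2)] \<open>0 < \<epsilon>\<close> by (intro uniform_limitD) auto
    then obtain d where "0 < d" "\<And>r y. r \<in> I \<Longrightarrow> r \<noteq> t \<Longrightarrow> dist r t < d \<Longrightarrow> dist (G r y) (G t y) < \<epsilon> / 2"
      by (auto simp: eventually_at)
    with \<open>0 < \<epsilon>\<close> show thesis by (intro that[of d]) (metis dist_self half_gt_zero)+
  qed
  obtain d2 where d2: "0 < d2" "\<And>y. dist y x < d2 \<Longrightarrow> dist (G t y) (G t x) < \<epsilon> / 2"
    using cont[OF tx(2)] \<open>0 < \<epsilon>\<close> unfolding continuous_on_iff by (metis UNIV_I half_gt_zero)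
  show "\<exists>d>0. \<forall>z'\<in>I \<times> UNIV. dist z' z < d \<longrightarrow>
      dist (case z' of (t, x) \<Rightarrow> G t x) (case z of (t, x) \<Rightarrow> G t x) < \<epsilon>"
  proof (intro exI[of _ "min d1 d2"] conjI ballI impI)
    fix z' assume z': "z' \<in> I \<times> (UNIV :: 'b set)" "dist z' z < min d1 d2"
    obtain r y where ry: "z' = (r, y)" "r \<in> I" using z' by auto
    have "dist r t < d1" "dist y x < d2"
      using z' dist_fst_le[of z' z] dist_snd_le[of z' z] by (auto simp: tx ry)
    then have "dist (G r y) (G t y) < \<epsilon> / 2" "dist (G t y) (G t x) < \<epsilon> / 2"
      using d1 d2 ry by auto
    then show "dist (case z' of (t, x) \<Rightarrow> G t x) (case z of (t, x) \<Rightarrow> G t x) < \<epsilon>"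
      using dist_triangle[of "G r y" "G t x" "G t y"] by (simp add: tx ry)
  qed (use d1 d2 in auto)
qed

section \<open>Continuity and growth drawn from the equation for \<open>vxx\<close>\<close>

text \<open>The time dependence of \<gamma> enters through mean-square continuity. Joint continuity
  of \<gamma> and the growth of \<open>v\<close> are to be derived from it. The field
  \<open>elliptic\<close> is the second equation solved for the space derivative of
  \<gamma>.\<close>

locale elliptic_constraint =
  fixes lam :: real and I :: "real set" and \<gamma> v vx vxx :: "real \<Rightarrow> real \<Rightarrow> real"
  assumes lam: "lam \<noteq> 0"
    and v_deriv: "\<And>t x. t \<in> I \<Longrightarrow> (v t has_real_derivative vx t x) (at x)"
    and vx_deriv: "\<And>t x. t \<in> I \<Longrightarrow> (vx t has_real_derivative vxx t x) (at x)"
    and v_cont: "continuous_on (I \<times> UNIV) (\<lambda>(t, x). v t x)"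
    and vx_cont: "continuous_on (I \<times> UNIV) (\<lambda>(t, x). vx t x)"
    and elliptic: "\<And>t x. t \<in> I \<Longrightarrow> (\<gamma> t has_real_derivative vxx t x - (\<gamma> t x)\<^sup>2 / (2 * lam)) (at x)"
    and L2: "\<And>t. t \<in> I \<Longrightarrow> square_integrable (\<gamma> t)"
    and L2_cont: "\<And>t. t \<in> I \<Longrightarrow>
      ((\<lambda>r. LINT x|lborel. (\<gamma> r x - \<gamma> t x)\<^sup>2) \<longlongrightarrow> 0) (at t within I)"
begin

definition h where "h t x = vx t x - \<gamma> t x" for t x

lemma h_deriv: "t \<in> I \<Longrightarrow> (h t has_real_derivative (\<gamma> t x)\<^sup>2 / (2 * lam)) (at x)"
  unfolding h_def by (rule derivative_eq_intros vx_deriv elliptic | simp)+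

lemma eventually_L2: "\<forall>\<^sub>F r in at t within I. square_integrable (\<gamma> r)"
  using L2 by (auto simp: eventually_at_filter)

text \<open>The space derivative of \<open>2 * lam * (h r y - h t y)\<close> is the difference of
  the squares of \<gamma>, which has an integrable majorant of small total mass. Its increments from
  0 are hence small uniformly in \<open>x\<close>.\<close>

lemma uniform_limit_h_diff:
  assumes t: "t \<in> I"
  shows "uniform_limit UNIV (\<lambda>r x. h r x - h r 0) (\<lambda>x. h t x - h t 0) (at t within I)"
proof (rule uniform_limitI)
  fix \<epsilon> :: real assume "0 < \<epsilon>"
  then have "0 < \<bar>2 * lam\<bar> * \<epsilon>" using lam by simp
  from eventually_square_diff_dominated[OF L2[OF t] eventually_L2 L2_cont[OF t] this]
  have "\<forall>\<^sub>F r in at t within I. \<exists>w. integrable lborel w \<and> (\<forall>x. 0 \<le> w x) \<and>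
    (\<forall>x. \<bar>(\<gamma> r x)\<^sup>2 - (\<gamma> t x)\<^sup>2\<bar> \<le> w x) \<and> (LINT x|lborel. w x) < \<bar>2 * lam\<bar> * \<epsilon>" .
  moreover have "\<forall>\<^sub>F r in at t within I. r \<in> I" by (simp add: eventually_at_filter)
  ultimately show "\<forall>\<^sub>F r in at t within I. \<forall>x\<in>UNIV. dist (h r x - h r 0) (h t x - h t 0) < \<epsilon>"
  proof eventually_elim
    case (elim r)
    then obtain w where w: "integrable lborel w" "\<And>x. 0 \<le> w x"
        "\<And>x. \<bar>(\<gamma> r x)\<^sup>2 - (\<gamma> t x)\<^sup>2\<bar> \<le> w x" "(LINT x|lborel. w x) < \<bar>2 * lam\<bar> * \<epsilon>"
      by blast
    show ?case
    proof
      fix x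
      have "((\<lambda>y. 2 * lam * (h r y - h t y)) has_real_derivative (\<gamma> r y)\<^sup>2 - (\<gamma> t y)\<^sup>2) (at y)" for y
        using lam by (auto intro!: derivative_eq_intros h_deriv elim t simp: field_simps)
      from increment_bound[OF this, of 0 w x] w
      have "\<bar>2 * lam * (h r x - h t x) - 2 * lam * (h r 0 - h t 0)\<bar> < \<bar>2 * lam\<bar> * \<epsilon>" by simp
      also have "2 * lam * (h r x - h t x) - 2 * lam * (h r 0 - h t 0) =
          2 * lam * ((h r x - h r 0) - (h t x - h t 0))" by (simp add: algebra_simps)
      finally have "\<bar>2 * lam\<bar> * \<bar>(h r x - h r 0) - (h t x - h t 0)\<bar> < \<bar>2 * lam\<bar> * \<epsilon>"
        unfolding abs_mult .
      then show "dist (h r x - h r 0) (h t x - h t 0) < \<epsilon>"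
        using lam by (simp add: dist_real_def)
    qed
  qed
qed

lemma continuous_on_at_point:
  assumes "continuous_on (I \<times> UNIV) (\<lambda>(t, x). f t x)"
  shows "continuous_on I (\<lambda>t. f t (x :: real))"
proof -
  have "continuous_on I (\<lambda>t. (t, x))" by (intro continuous_intros)
  from continuous_on_compose2[OF assms this] show ?thesis by auto
qed

text \<open>The mean over \<open>[0,1]\<close> of \<open>v\<^sub>x - \<gamma> = h\<close> is controlled by \<open>v\<close> at the end points and by the
  \<open>L\<^sup>2\<close> norm of \<open>\<gamma>\<close>, and \<open>h t x - h t 0\<close> is already known to be continuous in \<open>t\<close>.\<close>

lemma continuous_on_h0: "continuous_on I (\<lambda>t. h t 0)"
  unfolding continuous_on_def
proof (intro ballI tendstoI)
  fix t and \<epsilon> :: real assume t: "t \<in> I" and "0 < \<epsilon>"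
  \<comment> \<open>Five errors add up: \<open>v\<close> at 0, \<open>v\<close> at 1, and three in
    the increment of \<open>?\<phi>\<close>, namely the variation of \<open>h\<close> in space and
    the two terms bounding the difference of \<gamma>.\<close>
  define \<eta> where "\<eta> = \<epsilon> / 5"
  have \<eta>: "0 < \<eta>" using \<open>0 < \<epsilon>\<close> by (simp add: \<eta>_def)
  have "((\<lambda>r. v r x) \<longlongrightarrow> v t x) (at t within I)" for x
    using continuous_on_at_point[OF v_cont] t by (auto simp: continuous_on_def)
  then have v: "\<forall>\<^sub>F r in at t within I. dist (v r x) (v t x) < \<eta>" for x
    using \<eta> by (rule tendstoD)
  have "\<forall>\<^sub>F r in at t within I. (LINT x|lborel. (\<gamma> r x - \<gamma> t x)\<^sup>2) < \<eta> * \<eta>"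
    using L2_cont[OF t] \<eta> by (intro order_tendstoD(2)) auto
  moreover have "\<forall>\<^sub>F r in at t within I. r \<in> I" by (simp add: eventually_at_filter)
  ultimately show "\<forall>\<^sub>F r in at t within I. dist (h r 0) (h t 0) < \<epsilon>"
    using v[of 0] v[of 1] uniform_limitD[OF uniform_limit_h_diff[OF t] \<eta>]
  proof eventually_elim
    case (elim r)
    \<comment> \<open>The increment of \<open>?\<phi>\<close> over the unit interval contains
      \<open>h r 0 - h t 0\<close> with coefficient -1, next to values of \<open>v\<close> that are
      already controlled.\<close>
    let ?\<phi> = "\<lambda>x. v r x - v t x - (h r 0 - h t 0) * x"
    let ?w = "\<lambda>x. (\<gamma> r x - \<gamma> t x)\<^sup>2 / \<eta>"
    have deriv: "(?\<phi> has_real_derivative vx r y - vx t y - (h r 0 - h t 0)) (at y)" for y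
      by (auto intro!: derivative_eq_intros v_deriv elim t)
    \<comment> \<open>This trades the difference of \<gamma> for its square, the quantity whose
      integral is below \<open>\<eta> * \<eta>\<close>; division by \<open>\<eta>\<close> leaves
      less than \<open>\<eta>\<close>.\<close>
    have "\<bar>d\<bar> \<le> \<eta> + d\<^sup>2 / \<eta>" for d
    proof (cases "\<bar>d\<bar> \<le> \<eta>")
      case False
      then have "\<bar>d\<bar> * \<eta> \<le> \<bar>d\<bar> * \<bar>d\<bar>" by (intro mult_left_mono) auto
      then show ?thesis using \<eta> by (simp add: field_simps power2_eq_square add_increasing)
    qed (use \<eta> in \<open>simp add: add_increasing2\<close>)
    from this[of "\<gamma> r y - \<gamma> t y" for y] elim(5)
    have bound: "\<bar>vx r y - vx t y - (h r 0 - h t 0)\<bar> \<le> 2 * \<eta> + ?w y" for y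
      unfolding h_def dist_real_def by (smt (verit) UNIV_I)
    have int: "integrable lborel ?w"
      using square_integrable_diff[OF L2 L2, of r t] elim t by (simp add: square_integrable_def)
    have "\<bar>?\<phi> 1 - ?\<phi> 0\<bar> \<le> 2 * \<eta> * \<bar>1\<bar> + (LINT x|lborel. ?w x)"
      using deriv bound int by (rule increment_bound) (use \<eta> in auto)
    also have "(LINT x|lborel. ?w x) < \<eta>"
      using elim(1) \<eta> by (simp add: field_simps)
    finally have "\<bar>?\<phi> 1 - ?\<phi> 0\<bar> < 3 * \<eta>" by simp
    with elim(3,4) show ?case
      unfolding dist_real_def by (simp add: \<eta>_def abs_if split: if_splits)
  qed
qed

text \<open>Decompose \<gamma> as \<open>vx\<close> minus \<open>h t x - h t 0\<close> minus
  \<open>h t 0\<close>. The middle term is continuous in time uniformly in \<open>x\<close>, and the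
  last depends on time alone.\<close>

lemma continuous_on_\<gamma>: "continuous_on (I \<times> UNIV) (\<lambda>(t, x). \<gamma> t x)"
proof -
  have "continuous_on UNIV (h t)" if "t \<in> I" for t
    using h_deriv[OF that] by (meson DERIV_isCont continuous_at_imp_continuous_on)
  then have G: "continuous_on (I \<times> UNIV) (\<lambda>(t, x). h t x - h t 0)"
    by (intro continuous_on_Times_uniform_limit uniform_limit_h_diff continuous_intros)
  have H: "continuous_on (I \<times> UNIV) (\<lambda>z. h (fst z) 0)"
    by (intro continuous_on_compose2[OF continuous_on_h0] continuous_intros) auto
  show ?thesis
    using continuous_on_diff[OF continuous_on_diff[OF vx_cont G] H] by (simp add: case_prod_beta h_def)
qed

text \<open>On a compact time interval \<open>h\<close> is bounded, by its value at 0 and the mass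
  of the square of \<gamma>. So \<open>vx = h + \<gamma>\<close> is bounded up to an integrable
  term, and integration from 0 gives linear growth of \<open>v\<close>.\<close>

lemma linear_growth:
  assumes sub: "{0..t1} \<subseteq> I"
  obtains A B where "0 \<le> A" "0 \<le> B" "\<And>t x. 0 \<le> t \<Longrightarrow> t \<le> t1 \<Longrightarrow> \<bar>v t x\<bar> \<le> A + B * \<bar>x\<bar>"
proof -
  define N where "N t = (LINT x|lborel. (\<gamma> t x)\<^sup>2)" for t
  have "continuous_on I N"
    unfolding continuous_on_def N_def
    by (intro ballI tendsto_L2_square L2 eventually_L2 L2_cont)
  moreover have "\<exists>C. \<forall>t\<in>{0..t1}. \<bar>f t\<bar> \<le> C" if "continuous_on I f" for f :: "real \<Rightarrow> real"
  proof -
    have "compact (f ` {0..t1})"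
      using that sub by (intro compact_continuous_image) (auto intro: continuous_on_subset)
    then show ?thesis using compact_imp_bounded by (force simp: bounded_iff)
  qed
  ultimately obtain CN Ch Cv where C: "\<And>t. t \<in> {0..t1} \<Longrightarrow> \<bar>N t\<bar> \<le> CN"
      "\<And>t. t \<in> {0..t1} \<Longrightarrow> \<bar>h t 0\<bar> \<le> Ch" "\<And>t. t \<in> {0..t1} \<Longrightarrow> \<bar>v t 0\<bar> \<le> Cv"
    using continuous_on_h0 continuous_on_at_point[OF v_cont, of 0] by metis
  \<comment> \<open>The bound for \<open>h\<close> plus the constant in
    \<open>\<bar>y\<bar> \<le> 1 / 2 + y\<^sup>2 / 2\<close>; the square term there integrates to at
    most \<open>CN / 2\<close>.\<close>
  define B where "B = Ch + CN / (2 * \<bar>lam\<bar>) + 1 / 2"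
  have growth: "\<bar>v t x\<bar> \<le> Cv + CN / 2 + B * \<bar>x\<bar>" if t: "t \<in> {0..t1}" for t x
  proof -
    have tI: "t \<in> I" using t sub by auto
    have int: "integrable lborel (\<lambda>x. (\<gamma> t x)\<^sup>2)" using L2[OF tI] by (simp add: square_integrable_def)
    have hx: "\<bar>h t y\<bar> \<le> Ch + CN / (2 * \<bar>lam\<bar>)" for y
    proof -
      have "\<bar>h t y - h t 0\<bar> \<le> 0 * \<bar>y\<bar> + (LINT x|lborel. (\<gamma> t x)\<^sup>2 / (2 * \<bar>lam\<bar>))"
        by (rule increment_bound[OF h_deriv[OF tI]]) (use int in \<open>auto simp: abs_mult\<close>)
      also have "\<dots> = N t / (2 * \<bar>lam\<bar>)" by (simp add: N_def)
      also have "\<dots> \<le> CN / (2 * \<bar>lam\<bar>)" using C(1)[OF t] lam by (intro divide_right_mono) auto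
      finally show ?thesis using C(2)[OF t] by linarith
    qed
    have "\<bar>y\<bar> \<le> 1 / 2 + y\<^sup>2 / 2" for y :: real
      using sum_squares_bound[of "\<bar>y\<bar>" 1] by simp
    from this[of "\<gamma> t y" for y] hx
    have "\<bar>vx t y\<bar> \<le> B + (\<gamma> t y)\<^sup>2 / 2" for y
      unfolding h_def B_def by (smt (verit))
    then have "\<bar>v t x - v t 0\<bar> \<le> B * \<bar>x\<bar> + (LINT x|lborel. (\<gamma> t x)\<^sup>2 / 2)"
      by (rule increment_bound[OF v_deriv[OF tI]]) (use int in auto)
    also have "(LINT x|lborel. (\<gamma> t x)\<^sup>2 / 2) = N t / 2" by (simp add: N_def)
    finally show ?thesis using C(1,3)[OF t] by linarith
  qed
  \<comment> \<open>Absolute values give the required signs even when \<open>{0..t1}\<close> is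
    empty and the constants are arbitrary.\<close>
  show thesis
  proof (rule that[of "\<bar>Cv + CN / 2\<bar>" "\<bar>B\<bar>"])
    fix t x assume "0 \<le> t" "t \<le> t1"
    then have "\<bar>v t x\<bar> \<le> Cv + CN / 2 + B * \<bar>x\<bar>" using growth by simp
    also have "\<dots> \<le> \<bar>Cv + CN / 2\<bar> + \<bar>B\<bar> * \<bar>x\<bar>" by (intro add_mono mult_right_mono) auto
    finally show "\<bar>v t x\<bar> \<le> \<dots>" .
  qed auto
qed

end

subsection \<open>Propagation of the support\<close>

text \<open>By \<open>growth\<close>, the quantity \<open>1 + x\<^sup>2\<close> changes along the
  flow at relative rate at most \<open>M\<close>, whence the factor \<open>exp (M * t0)\<close> in
  the threshold. A nonzero value beyond it would give \<open>F\<close> below a positive maximum on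
  the compact set \<open>S\<close>, where the derivative of \<open>F\<close> along the flow would be
  both nonnegative and negative.\<close>

lemma transport_vanishes_outside:
  fixes g v c :: "real \<Rightarrow> real \<Rightarrow> real"
  assumes cont_g: "continuous_on ({0..t1} \<times> UNIV) (\<lambda>(t, x). g t x)"
    and cont_c: "continuous_on ({0..t1} \<times> UNIV) (\<lambda>(t, x). c t x)"
    and transport: "\<And>t x. 0 < t \<Longrightarrow> t \<le> t1 \<Longrightarrow> \<exists>gx. (g t has_real_derivative gx) (at x) \<and>
      ((\<lambda>r. g r x) has_real_derivative c t x * g t x - v t x * gx) (at t)"
    and growth: "\<And>t x. 0 \<le> t \<Longrightarrow> t \<le> t1 \<Longrightarrow> \<bar>2 * x * v t x\<bar> \<le> M * (1 + x\<^sup>2)"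
    and init: "\<And>x. a < 1 + x\<^sup>2 \<Longrightarrow> g 0 x = 0"
    and t0: "0 \<le> t0" "t0 \<le> t1" and x0: "a * exp (M * t0) < 1 + x0\<^sup>2"
  shows "g t0 x0 = 0"
proof (rule ccontr)
  assume nz: "g t0 x0 \<noteq> 0"
  \<comment> \<open>With this \<open>b\<close>, \<open>q t0 x0 = 1\<close>. At time 0 positivity of
    \<open>p\<close> is the condition in \<open>init\<close>, while nonnegativity of
    \<open>q\<close> keeps \<open>S\<close> bounded.\<close>
  define b where "b = exp (M * t0) * (1 + x0\<^sup>2) + 1"
  define p where "p t x = exp (- (M * t)) * (1 + x\<^sup>2) - a" for t x :: real
  define q where "q t x = b - exp (M * t) * (1 + x\<^sup>2)" for t x :: real
  define S where "S = {z \<in> {0..t0} \<times> UNIV. 0 \<le> p (fst z) (snd z) \<and> 0 \<le> q (fst z) (snd z)}"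
  have M: "0 \<le> M"
    using growth[of 0 0] t0 by simp
  have p0: "0 < p t0 x0" and q0: "0 < q t0 x0"
    using x0 by (simp_all add: p_def q_def b_def exp_minus field_simps)
  have closed: "closed S"
  proof -
    have "closed ({0..t0} \<times> (UNIV :: real set))"
      by (intro closed_Times) auto
    moreover have "closed {z. 0 \<le> p (fst z) (snd z)}" "closed {z. 0 \<le> q (fst z) (snd z)}"
      unfolding p_def q_def by (intro closed_Collect_le continuous_intros)+
    moreover have "S = ({0..t0} \<times> UNIV) \<inter> {z. 0 \<le> p (fst z) (snd z)} \<inter> {z. 0 \<le> q (fst z) (snd z)}"
      by (auto simp: S_def)
    ultimately show ?thesis by (metis closed_Int)
  qed
  have "S \<subseteq> {0..t0} \<times> {- (1 + b)..1 + b}"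
  proof
    fix z assume "z \<in> S"
    then obtain t x where z: "z = (t, x)" "0 \<le> t" "t \<le> t0" "0 \<le> q t x"
      by (auto simp: S_def)
    have "1 * (1 + x\<^sup>2) \<le> exp (M * t) * (1 + x\<^sup>2)"
      using M z by (intro mult_right_mono) (auto intro: add_nonneg_nonneg)
    with z have xb: "x\<^sup>2 \<le> b" by (simp add: q_def)
    have "2 * \<bar>x\<bar> \<le> 1 + x\<^sup>2"
      using sum_squares_bound[of "\<bar>x\<bar>" 1] by simp
    with xb have "\<bar>x\<bar> \<le> 1 + b" by (smt (verit) zero_le_power2)
    with z show "z \<in> {0..t0} \<times> {- (1 + b)..1 + b}" by auto
  qed
  hence "bounded S"
    by (rule bounded_subset[rotated]) (intro bounded_Times bounded_closed_interval)
  with closed have comp: "compact S" by (simp add: compact_eq_bounded_closed)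
  have S_sub: "S \<subseteq> {0..t1} \<times> UNIV" using t0 by (auto simp: S_def)
  have "compact ((\<lambda>(t, x). c t x) ` S)"
    by (intro compact_continuous_image continuous_on_subset[OF cont_c] S_sub comp)
  then obtain C where "\<forall>y\<in>(\<lambda>(t, x). c t x) ` S. norm y \<le> C"
    using compact_imp_bounded bounded_iff by blast
  then have C: "\<And>t x. (t, x) \<in> S \<Longrightarrow> \<bar>c t x\<bar> \<le> C"
    by force
  \<comment> \<open>Chosen so that \<open>2 * c t x - K \<le> -1\<close> on \<open>S\<close>; the
    bound \<open>C\<close> for \<open>c\<close> holds on that compact set.\<close>
  define K where "K = 2 * C + 1"
  define F where "F t x = exp (- (K * t)) * (p t x * q t x * (g t x)\<^sup>2)" for t x
  have "continuous_on S (\<lambda>z. F (fst z) (snd z))"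
    unfolding F_def p_def q_def
    using continuous_on_subset[OF cont_g S_sub]
    by (intro continuous_intros) (auto simp: case_prod_beta)
  moreover have in0: "(t0, x0) \<in> S"
    using t0 p0 q0 by (auto simp: S_def)
  ultimately obtain t x where tx: "(t, x) \<in> S"
    and max: "\<And>r y. (r, y) \<in> S \<Longrightarrow> F r y \<le> F t x"
    using continuous_attains_sup[OF comp, of "\<lambda>z. F (fst z) (snd z)"] by fastforce
  have "0 < F t0 x0" using p0 q0 nz by (simp add: F_def)
  also have "\<dots> \<le> F t x" using max in0 .
  finally have pos: "0 < F t x" .
  \<comment> \<open>On the part of the boundary of \<open>S\<close> where \<open>p\<close> or
    \<open>q\<close> is zero, \<open>F\<close> is zero too, so a positive maximum avoids it.\<close>
  with tx have pq: "0 < p t x" "0 < q t x" and g: "g t x \<noteq> 0"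
    by (auto simp: F_def S_def zero_less_mult_iff less_le)
  have t: "0 \<le> t" "t \<le> t0" using tx by (auto simp: S_def)
  have "t \<noteq> 0"
  proof
    assume "t = 0"
    with pq have "a < 1 + x\<^sup>2" by (simp add: p_def)
    with init g \<open>t = 0\<close> show False by auto
  qed
  with t t0 have t': "0 < t" "t \<le> t1" by auto
  obtain gx where gx: "(g t has_real_derivative gx) (at x)"
    and gt: "((\<lambda>r. g r x) has_real_derivative c t x * g t x - v t x * gx) (at t)"
    using transport[OF t'] by blast
  define gt' where "gt' = c t x * g t x - v t x * gx"
  define px qx pt qt where "px = exp (- (M * t)) * (2 * x)" and "qx = - exp (M * t) * (2 * x)"
    and "pt = - M * exp (- (M * t)) * (1 + x\<^sup>2)" and "qt = - M * exp (M * t) * (1 + x\<^sup>2)"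
  define Fx where "Fx = exp (- (K * t)) *
    (px * q t x * (g t x)\<^sup>2 + p t x * qx * (g t x)\<^sup>2 + p t x * q t x * (2 * g t x * gx))"
  define Ft where "Ft = - K * F t x + exp (- (K * t)) *
    (pt * q t x * (g t x)\<^sup>2 + p t x * qt * (g t x)\<^sup>2 + p t x * q t x * (2 * g t x * gt'))"
  have DFx: "((\<lambda>y. F t y) has_real_derivative Fx) (at x)"
    unfolding F_def p_def q_def Fx_def px_def qx_def
    by (auto intro!: derivative_eq_intros gx simp: algebra_simps power2_eq_square)
  have DFt: "((\<lambda>r. F r x) has_real_derivative Ft) (at t)"
    unfolding F_def p_def q_def Ft_def pt_def qt_def gt'_def
    by (auto intro!: derivative_eq_intros gt simp: algebra_simps power2_eq_square)
  have "\<forall>\<^sub>F y in nhds x. 0 < p t y \<and> 0 < q t y"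
  proof (intro eventually_conj)
    have "isCont (p t) x" "isCont (q t) x" unfolding p_def q_def by (intro continuous_intros)+
    then show "\<forall>\<^sub>F y in nhds x. 0 < p t y" "\<forall>\<^sub>F y in nhds x. 0 < q t y"
      using pq by (auto simp: continuous_at tendsto_at_iff_tendsto_nhds dest: order_tendstoD(1))
  qed
  then obtain d where d: "0 < d" "\<And>y. \<bar>y - x\<bar> < d \<Longrightarrow> 0 < p t y \<and> 0 < q t y"
    by (auto simp: eventually_nhds_metric dist_real_def)
  \<comment> \<open>At the fixed time \<open>t\<close> all nearby \<open>y\<close> stay in
    \<open>S\<close>, so the maximum is interior in space.\<close>
  have "Fx = 0"
  proof (rule DERIV_local_max[OF DFx \<open>0 < d\<close>], intro allI impI)
    fix y assume "\<bar>x - y\<bar> < d"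
    hence "(t, y) \<in> S" using d(2)[of y] t by (auto simp: S_def abs_minus_commute)
    thus "F t y \<le> F t x" by (rule max)
  qed
  have "\<forall>\<^sub>F r in nhds t. 0 < p r x \<and> 0 < q r x"
  proof (intro eventually_conj)
    have "isCont (\<lambda>r. p r x) t" "isCont (\<lambda>r. q r x) t" unfolding p_def q_def by (intro continuous_intros)+
    then show "\<forall>\<^sub>F r in nhds t. 0 < p r x" "\<forall>\<^sub>F r in nhds t. 0 < q r x"
      using pq tendsto_at_iff_tendsto_nhds[of "\<lambda>r. p r x" t] tendsto_at_iff_tendsto_nhds[of "\<lambda>r. q r x" t]
      by (auto simp: continuous_at dest: order_tendstoD(1))
  qed
  then obtain e where e: "0 < e" "\<And>r. \<bar>r - t\<bar> < e \<Longrightarrow> 0 < p r x \<and> 0 < q r x"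
    by (auto simp: eventually_nhds_metric dist_real_def)
  \<comment> \<open>Only earlier times are compared, since \<open>t\<close> may be the final time
    \<open>t0\<close>. Halving the minimum keeps \<open>t - h\<close> positive and \<open>h\<close>
    strictly below both radii.\<close>
  have "0 \<le> Ft"
  proof (rule ccontr)
    assume "\<not> 0 \<le> Ft"
    then obtain d' where d': "0 < d'" "\<And>h. 0 < h \<Longrightarrow> h < d' \<Longrightarrow> F t x < F (t - h) x"
      using DERIV_neg_dec_left[OF DFt] by auto
    define h where "h = min (min d' e) t / 2"
    have h: "0 < h" "h < d'" "h < e" "h < t"
      using d' e t' by (auto simp: h_def min_def)
    hence "(t - h, x) \<in> S" using e(2)[of "t - h"] t by (auto simp: S_def)
    with max d'(2)[OF h(1,2)] show False by fastforce
  qed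
  text \<open>Transport decreases both \<open>p\<close> and \<open>q\<close>.\<close>
  have gr: "\<bar>2 * x * v t x\<bar> \<le> M * (1 + x\<^sup>2)" using growth t' by auto
  have "pt + v t x * px = exp (- (M * t)) * (2 * x * v t x - M * (1 + x\<^sup>2))"
    by (simp add: pt_def px_def algebra_simps)
  also have "\<dots> \<le> 0" using gr by (intro mult_nonneg_nonpos) auto
  finally have p1: "pt + v t x * px \<le> 0" .
  have "qt + v t x * qx = exp (M * t) * (- (2 * x * v t x) - M * (1 + x\<^sup>2))"
    by (simp add: qt_def qx_def algebra_simps)
  also have "\<dots> \<le> 0" using gr by (intro mult_nonneg_nonpos) auto
  finally have q1: "qt + v t x * qx \<le> 0" .
  \<comment> \<open>In the derivative along the flow the terms with \<open>gx\<close> cancel,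
    because \<open>gt' + v t x * gx = c t x * g t x\<close>.\<close>
  have "Ft + v t x * Fx = (2 * c t x - K) * F t x + exp (- (K * t)) * (g t x)\<^sup>2 *
      ((pt + v t x * px) * q t x + p t x * (qt + v t x * qx))"
    unfolding Ft_def Fx_def F_def gt'_def by (simp add: algebra_simps power2_eq_square)
  also have "\<dots> \<le> (2 * c t x - K) * F t x"
  proof -
    have "(pt + v t x * px) * q t x \<le> 0" using p1 pq by (intro mult_nonpos_nonneg) auto
    moreover have "p t x * (qt + v t x * qx) \<le> 0" using q1 pq by (intro mult_nonneg_nonpos) auto
    ultimately have "exp (- (K * t)) * (g t x)\<^sup>2 *
      ((pt + v t x * px) * q t x + p t x * (qt + v t x * qx)) \<le> 0"
      by (intro mult_nonneg_nonpos) auto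
    thus ?thesis by simp
  qed
  also have "\<dots> < 0"
    using C[OF tx] pos by (intro mult_neg_pos) (auto simp: K_def)
  finally show False using \<open>Fx = 0\<close> \<open>0 \<le> Ft\<close> by simp
qed

section \<open>Compact support of the solution\<close>

lemma has_compact_support_iff:
  "has_compact_support f \<longleftrightarrow> (\<exists>r. \<forall>x. f x \<noteq> 0 \<longrightarrow> \<bar>x\<bar> \<le> r)"
  by (simp add: has_compact_support_def bounded_iff)

theorem theorem4p1:
  fixes lam s :: real
    and \<gamma>0 :: "real \<Rightarrow> real"
    and T :: ereal
    and \<gamma> :: "real \<Rightarrow> real \<Rightarrow> real"
  assumes "lam \<noteq> 0"
    and "4 \<le> s"
    and "\<gamma>0 \<in> sobolev_space s"
    and "has_compact_support \<gamma>0"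
    and "maximal_solution lam s \<gamma>0 T \<gamma>"
  shows "\<forall>t\<in>{t. 0 \<le> t \<and> ereal t < T}. has_compact_support (\<gamma> t)"
proof
  fix t1 assume "t1 \<in> {t. 0 \<le> t \<and> ereal t < T}"
  then have t1: "0 \<le> t1" "ereal t1 < T" by auto
  define I where "I = time_interval T"
  have sub: "{0..t1} \<subseteq> I"
    using t1 by (auto simp: I_def time_interval_def intro: le_less_trans[rotated])
  obtain v vx vxx where
      C0: "sobolev_C0 s I \<gamma>"
    and v_deriv: "\<forall>t\<in>I. \<forall>x. (v t has_real_derivative vx t x) (at x)"
    and vx_deriv: "\<forall>t\<in>I. \<forall>x. (vx t has_real_derivative vxx t x) (at x)"
    and v_cont: "continuous_on (I \<times> UNIV) (\<lambda>(t, x). v t x)"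
    and vx_cont: "continuous_on (I \<times> UNIV) (\<lambda>(t, x). vx t x)"
    and evolution: "\<forall>t\<in>I. 0 < t \<longrightarrow> (\<forall>x. \<exists>D.
      ((\<lambda>y. vx t y - \<gamma> t y - 1 / lam * v t y * \<gamma> t y) has_real_derivative D) (at x) \<and>
      ((\<lambda>r. \<gamma> r x) has_real_derivative lam * D) (at t))"
    and elliptic: "\<forall>t\<in>I. \<forall>x. \<exists>\<gamma>x. (\<gamma> t has_real_derivative \<gamma>x) (at x) \<and>
      vxx t x = \<gamma>x + (\<gamma> t x)\<^sup>2 / (2 * lam)"
    and init: "\<forall>x. \<gamma> 0 x = \<gamma>0 x"
    using assms(5) unfolding maximal_solution_def classical_solution_def classical_solution_pair_def
      I_def[symmetric] by blast
  have \<gamma>_deriv: "(\<gamma> t has_real_derivative vxx t x - (\<gamma> t x)\<^sup>2 / (2 * lam)) (at x)" if "t \<in> I" for t x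
  proof -
    obtain \<gamma>x where "(\<gamma> t has_real_derivative \<gamma>x) (at x)" "vxx t x = \<gamma>x + (\<gamma> t x)\<^sup>2 / (2 * lam)"
      using elliptic \<open>t \<in> I\<close> by blast
    then show ?thesis by simp
  qed
  have \<gamma>_cont: "continuous_on UNIV (\<gamma> t)" if "t \<in> I" for t
    using \<gamma>_deriv[OF that] by (meson DERIV_isCont continuous_at_imp_continuous_on)
  have \<gamma>_space: "\<gamma> t \<in> sobolev_space s" if "t \<in> I" for t
    using C0 that by (simp add: sobolev_C0_def)
  \<comment> \<open>The mean-square distance is squeezed between 0 and the square of the Sobolev
    distance.\<close>
  have L2_cont: "((\<lambda>r. LINT x|lborel. (\<gamma> r x - \<gamma> t x)\<^sup>2) \<longlongrightarrow> 0) (at t within I)" if t: "t \<in> I" for t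
  proof (rule tendsto_sandwich[where f = "\<lambda>_. 0"])
    show "((\<lambda>r. (sobolev_norm s (\<lambda>x. \<gamma> r x - \<gamma> t x))\<^sup>2) \<longlongrightarrow> 0) (at t within I)"
      using C0 t tendsto_power[of "\<lambda>r. sobolev_norm s (\<lambda>x. \<gamma> r x - \<gamma> t x)" 0 "at t within I" 2]
      by (simp add: sobolev_C0_def)
    have "\<forall>\<^sub>F r in at t within I. r \<in> I" by (simp add: eventually_at_filter)
    then show "\<forall>\<^sub>F r in at t within I.
        (LINT x|lborel. (\<gamma> r x - \<gamma> t x)\<^sup>2) \<le> (sobolev_norm s (\<lambda>x. \<gamma> r x - \<gamma> t x))\<^sup>2"
    proof eventually_elim
      case (elim r)
      show ?case
        using assms(2) t elim
        by (intro L2_le_sobolev_norm sobolev_space_diff \<gamma>_space continuous_on_diff \<gamma>_cont) auto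
    qed
  qed auto
  interpret elliptic_constraint lam I \<gamma> v vx vxx
    using assms(1) v_deriv vx_deriv v_cont vx_cont \<gamma>_deriv \<gamma>_space L2_cont
    by unfold_locales (auto simp: sobolev_space_def)
  obtain A B where AB: "0 \<le> A" "0 \<le> B" "\<And>t x. 0 \<le> t \<Longrightarrow> t \<le> t1 \<Longrightarrow> \<bar>v t x\<bar> \<le> A + B * \<bar>x\<bar>"
    using linear_growth[OF sub] by blast
  obtain \<rho> where \<rho>: "\<And>x. \<gamma>0 x \<noteq> 0 \<Longrightarrow> \<bar>x\<bar> \<le> \<rho>"
    using assms(4) by (auto simp: has_compact_support_iff)
  \<comment> \<open>From \<open>2 * \<bar>x\<bar> * (A + B * \<bar>x\<bar>)\<close>, using
    \<open>2 * \<bar>x\<bar> \<le> 1 + x\<^sup>2\<close> for the first term and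
    \<open>x\<^sup>2 \<le> 1 + x\<^sup>2\<close> for the second.\<close>
  define M where "M = A + 2 * B"
  define a where "a = 1 + \<rho>\<^sup>2"
  have sub': "{0..t1} \<times> UNIV \<subseteq> I \<times> (UNIV :: real set)" using sub by auto
  have cont_g: "continuous_on ({0..t1} \<times> UNIV) (\<lambda>(t, x). \<gamma> t x)"
    by (rule continuous_on_subset[OF continuous_on_\<gamma> sub'])
  have cont_c: "continuous_on ({0..t1} \<times> UNIV) (\<lambda>(t, x). \<gamma> t x / 2 - vx t x)"
    using continuous_on_subset[OF continuous_on_\<gamma> sub'] continuous_on_subset[OF vx_cont sub']
    by (simp add: case_prod_beta continuous_on_diff continuous_on_divide)
  have transport: "\<exists>gx. (\<gamma> t has_real_derivative gx) (at x) \<and>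
      ((\<lambda>r. \<gamma> r x) has_real_derivative (\<gamma> t x / 2 - vx t x) * \<gamma> t x - v t x * gx) (at t)"
    if t: "0 < t" "t \<le> t1" for t x
  proof -
    have tI: "t \<in> I" using t sub by auto
    define gx where "gx = vxx t x - (\<gamma> t x)\<^sup>2 / (2 * lam)"
    have gx: "(\<gamma> t has_real_derivative gx) (at x)" and gx_eq: "vxx t x = gx + (\<gamma> t x)\<^sup>2 / (2 * lam)"
      using \<gamma>_deriv[OF tI] by (simp_all add: gx_def)
    obtain D where D: "((\<lambda>y. vx t y - \<gamma> t y - 1 / lam * v t y * \<gamma> t y) has_real_derivative D) (at x)"
      and Dt: "((\<lambda>r. \<gamma> r x) has_real_derivative lam * D) (at t)"
      using evolution tI t by blast
    \<comment> \<open>The product rule identifies \<open>D\<close>. Replacing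
      \<open>vxx t x - gx\<close> by the quadratic term then removes all second derivatives and
      leaves the transport form.\<close>
    have "((\<lambda>y. vx t y - \<gamma> t y - 1 / lam * v t y * \<gamma> t y) has_real_derivative
        vxx t x - gx - 1 / lam * (vx t x * \<gamma> t x + v t x * gx)) (at x)"
      using assms(1) v_deriv vx_deriv tI
      by (auto intro!: derivative_eq_intros gx simp: field_simps)
    from DERIV_unique[OF D this]
    have "lam * D = (\<gamma> t x / 2 - vx t x) * \<gamma> t x - v t x * gx"
      using assms(1) by (simp add: gx_eq field_simps power2_eq_square)
    with Dt gx show ?thesis by metis
  qed
  have growth: "\<bar>2 * x * v t x\<bar> \<le> M * (1 + x\<^sup>2)" if t: "0 \<le> t" "t \<le> t1" for t x
  proof -
    have "\<bar>2 * x * v t x\<bar> = 2 * \<bar>x\<bar> * \<bar>v t x\<bar>" by (simp add: abs_mult)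
    also have "\<dots> \<le> 2 * \<bar>x\<bar> * (A + B * \<bar>x\<bar>)" using AB(3)[OF t] by (intro mult_left_mono) auto
    also have "\<dots> = A * (2 * \<bar>x\<bar>) + 2 * B * x\<^sup>2"
      by (simp add: algebra_simps power2_eq_square flip: abs_mult)
    also have "\<dots> \<le> A * (1 + x\<^sup>2) + 2 * B * (1 + x\<^sup>2)"
      using AB sum_squares_bound[of "\<bar>x\<bar>" 1] by (intro add_mono mult_left_mono) auto
    also have "\<dots> = M * (1 + x\<^sup>2)" by (simp add: M_def algebra_simps)
    finally show ?thesis .
  qed
  have outside: "\<gamma> 0 x = 0" if "a < 1 + x\<^sup>2" for x
  proof (rule ccontr)
    assume "\<gamma> 0 x \<noteq> 0"
    then have "\<bar>x\<bar>\<^sup>2 \<le> \<rho>\<^sup>2" using \<rho> init by (intro power_mono) auto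
    with that show False by (simp add: a_def)
  qed
  have vanish: "\<gamma> t1 x = 0" if "a * exp (M * t1) < 1 + x\<^sup>2" for x
    using cont_g cont_c transport growth outside t1(1) order_refl that
    by (rule transport_vanishes_outside)
  have "\<bar>x\<bar> \<le> 1 + a * exp (M * t1)" if "\<gamma> t1 x \<noteq> 0" for x
  proof -
    have "1 + x\<^sup>2 \<le> a * exp (M * t1)" using vanish[of x] that by force
    moreover have "2 * \<bar>x\<bar> \<le> x\<^sup>2 + 1" using sum_squares_bound[of "\<bar>x\<bar>" 1] by simp
    ultimately show ?thesis by linarith
  qed
  then show "has_compact_support (\<gamma> t1)"
    by (auto simp: has_compact_support_iff)
qed

end
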